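(* Let $M$ be a connected $C^1$-Fréchet manifold endowed with a Finsler structure on $TM$ whose associated Finsler metric $\rho$ is complete, and let $\varphi: M\to\mathbb{R}$ be a non-constant closed $C^1$-functional satisfying the Palais-Smale condition on $M$ at every level $c\in\mathbb{R}$. If $\varphi$ has two (distinct) local minimum points, then $\varphi$ has at least one more critical point, i.e. a critical point different from these two.
   Context: Keller $C^1$ maps: for Fréchet spaces $E,F$, a continuous map $f: U \to F$ on an open $U\subset E$ is $C^1$ if the directional derivatives $\mathrm{D}f(x)h = \lim_{t\to 0} (f(x+th)-f(x))/t$ exist for all $x\in U$, $h \in E$, and $x \mapsto \mathrm{D}f(x)$ is a continuous map from $U$ into the space $L(E,F)$ of continuous linear maps with the compact-open topology (uniform convergence on compact sets). A $C^1$-Fréchet manifold is a Hausdorff second countable manifold modeled on a Fréchet space $F$, with an atlas whose transition functions are all Keller $C^1$. A $C^1$-functional is a real-valued function of class $C^1$ in this sense (in charts). A map is closed if it maps closed sets to closed sets. Finsler structure: a Finsler structure on a trivial bundle $V = T\times F$ ($T$ a topological space, $F$ a Fréchet space) is a collection of continuous functions $\|\cdot\|_{V,n}: V\to \mathbb{R}^+$ (nonnegative values), $n\in\mathbb{N}$, such that (F1) for each fixed $b\in T$, $\|x\|^b_{F,n} := \|(b,x)\|_{V,n}$ is a collection of seminorms on $F$ giving the topology of $F$; (F2) for every $k>1$ and $x_0 \in T$ there is a neighborhood $W$ of $x_0$ with $\frac1k \|x\|^{x_0}_{F,n} \le \|x\|^{w}_{F,n}\le k\|x\|^{x_0}_{F,n}$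 for all $w\in W$, $n \in\mathbb{N}$, $x\in F$. A Finsler structure for $TM$ is a collection of continuous functions $\|\cdot\|_{M,n}: TM\to\mathbb{R}^+$ such that around each point there is a bundle chart $\psi: U\times F\simeq TM|_U$ through which they become a Finsler structure for $U\times F$. We take it graded: $\|\cdot\|_{M,n}\le \|\cdot\|_{M,n+1}$ for all $n$. The length of a piecewise $C^1$ curve $g:[a,b]\to M$ with respect to the $n$-th component is $L_n(g)=\int_a^b \|g'(t)\|_{M,n}^{g(t)}\,dt$; $\rho_n(x,y)$ is the infimum of $L_n$ over piecewise $C^1$ curves connecting $x$ to $y$; the Finsler metric is $\rho(x,y)=\sum_{n\ge1} 2^{-n}\frac{\rho_n(x,y)}{1+\rho_n(x,y)}$, which induces the topology of $M$. Critical points: for $x\in M$, $h\in T_xM$ and a chart $(x\in U,\psi)$ with induced map $\psi_*(x):T_xM\to F$, $\varphi'(x,h)=\lim_{t\to0}\big(\varphi(\psi^{-1}(\psi(x)+t\psi_*(x)(h)))-\varphi(x)\big)/t$. A point $x$ is critical for $\varphi$ if $(\varphi\circ\psi^{-1})'(\psi(x))=0$ for one (hence every) chart $\psi$ at $x$. Palais-Smale condition: let $B_\infty(0_x) = \bigcap_{n\ge1}\{h\in T_xM : \|h\|^x_{M,n}\le 1\}$ and $\Phi_\varphi(x)=\inf\{\varphi'(x,h): h\in B_\infty(0_x)\}$. The functional $\varphi$ satisfies the Palais-Smale condition at level $c\in\mathbb{R}$ in a set $A\subset M$ if every sequence $(m_i)\subset A$ with $\varphi(m_i)\to c$ and $\Phi_\varphi(m_i)\to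 0$ has a convergent subsequence; "on $M$" means $A=M$. *)

theory Defs
  imports "HOL-Analysis.Analysis"
begin

section \<open>Frechet spaces\<close>

class real_vector_t2 = real_vector + t2_space
begin

definition seminorm :: "('a \<Rightarrow> real) \<Rightarrow> bool" where
  "seminorm p \<longleftrightarrow>
     (\<forall>x y. p (x + y) \<le> p x + p y) \<and> (\<forall>c x. p (c *\<^sub>R x) = \<bar>c\<bar> * p x)"

definition generating_seminorms :: "(nat \<Rightarrow> 'a \<Rightarrow> real) \<Rightarrow> bool" where
  "generating_seminorms p \<longleftrightarrow>
     (\<forall>n. seminorm (p n)) \<and>
     (\<forall>S. open S \<longleftrightarrow> (\<forall>x\<in>S. \<exists>n e. e > 0 \<and> {y. \<forall>i\<le>n. p i (y - x) < e} \<subseteq> S))"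

definition complete_seminorms :: "(nat \<Rightarrow> 'a \<Rightarrow> real) \<Rightarrow> bool" where
  "complete_seminorms p \<longleftrightarrow>
     (\<forall>X :: nat \<Rightarrow> 'a.
        (\<forall>n. \<forall>e>0. \<exists>k. \<forall>i\<ge>k. \<forall>j\<ge>k. p n (X i - X j) < e) \<longrightarrow>
        (\<exists>l. \<forall>n. (\<lambda>i. p n (X i - l)) \<longlonglongrightarrow> 0))"

end

class frechet_space = real_vector_t2 +
  assumes frechet_seminorms:
    "\<exists>p :: nat \<Rightarrow> 'a \<Rightarrow> real. generating_seminorms p \<and> complete_seminorms p"

instance banach \<subseteq> real_vector_t2 ..

instance banach \<subseteq> frechet_space
proof
  let ?p = "\<lambda>_::nat. norm :: 'a \<Rightarrow> real"
  have const: "(\<forall>i\<le>n. Q) \<longleftrightarrow> Q" for n :: nat and Q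
    by blast
  have "generating_seminorms ?p"
    unfolding generating_seminorms_def seminorm_def const
    by (simp add: norm_triangle_ineq open_dist dist_norm subset_eq)
  moreover have "complete_seminorms ?p"
    unfolding complete_seminorms_def
  proof (intro allI impI)
    fix X :: "nat \<Rightarrow> 'a"
    assume *: "\<forall>n::nat. \<forall>e>0. \<exists>k. \<forall>i\<ge>k. \<forall>j\<ge>k. norm (X i - X j) < e"
    have "Cauchy X"
      using * by (auto simp: Cauchy_def dist_norm)
    then obtain l where "X \<longlonglongrightarrow> l"
      using Cauchy_convergent_iff convergent_def by blast
    then show "\<exists>l. \<forall>n::nat. (\<lambda>i. norm (X i - l)) \<longlonglongrightarrow> 0"
      using LIM_zero tendsto_norm_zero by blast
  qed
  ultimately show "\<exists>p :: nat \<Rightarrow> 'a \<Rightarrow> real. generating_seminorms p \<and> complete_seminorms p"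
    by blast
qed


section \<open>Keller $C^1$ maps\<close>

definition has_dir_derivative ::
    "('e::frechet_space \<Rightarrow> 'f::frechet_space) \<Rightarrow> 'e \<Rightarrow> 'e \<Rightarrow> 'f \<Rightarrow> bool" where
  "has_dir_derivative f x h l \<longleftrightarrow>
     ((\<lambda>t::real. (1 / t) *\<^sub>R (f (x + t *\<^sub>R h) - f x)) \<longlongrightarrow> l) (at 0)"

definition dir_derivative ::
    "('e::frechet_space \<Rightarrow> 'f::frechet_space) \<Rightarrow> 'e \<Rightarrow> 'e \<Rightarrow> 'f" where
  "dir_derivative f x h = (THE l. has_dir_derivative f x h l)"

definition continuous_linear_maps :: "('e::frechet_space \<Rightarrow> 'f::frechet_space) set" where
  "continuous_linear_maps = {T. linear T \<and> continuous_on UNIV T}"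

definition compact_open_topology :: "('e::frechet_space \<Rightarrow> 'f::frechet_space) topology" where
  "compact_open_topology =
     topology_generated_by
       {{T \<in> continuous_linear_maps. T ` K \<subseteq> V} |K V. compact K \<and> open V}"

definition keller_C1_on ::
    "'e set \<Rightarrow> ('e::frechet_space \<Rightarrow> 'f::frechet_space) \<Rightarrow> bool" where
  "keller_C1_on U f \<longleftrightarrow>
     open U \<and> continuous_on U f \<and>
     (\<forall>x\<in>U. \<forall>h. \<exists>l. has_dir_derivative f x h l) \<and>
     continuous_map (top_of_set U) compact_open_topology (dir_derivative f)"


section \<open>Manifolds and their tangent bundles\<close>

text \<open>A chart is a pair of its domain and a map; only the values of the map on the
  domain matter. The underlying set of a manifold is a whole type.\<close>

type_synonym ('m, 'f) chart = "'m set \<times> ('m \<Rightarrow> 'f)"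

abbreviation chart_dom :: "('m, 'f) chart \<Rightarrow> 'm set" where
  "chart_dom \<equiv> fst"

abbreviation chart_map :: "('m, 'f) chart \<Rightarrow> 'm \<Rightarrow> 'f" where
  "chart_map \<equiv> snd"

definition chart_inv :: "('m, 'f) chart \<Rightarrow> 'f \<Rightarrow> 'm" where
  "chart_inv c = inv_into (chart_dom c) (chart_map c)"

definition C1_frechet_atlas ::
    "('m::{t2_space, second_countable_topology}, 'f::frechet_space) chart set \<Rightarrow> bool" where
  "C1_frechet_atlas A \<longleftrightarrow>
     (\<Union>c\<in>A. chart_dom c) = UNIV \<and>
     (\<forall>c\<in>A. open (chart_dom c) \<and> open (chart_map c ` chart_dom c) \<and>
        homeomorphism (chart_dom c) (chart_map c ` chart_dom c) (chart_map c) (chart_inv c)) \<and>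
     (\<forall>c\<in>A. \<forall>d\<in>A.
        keller_C1_on (chart_map c ` (chart_dom c \<inter> chart_dom d)) (chart_map d \<circ> chart_inv c))"

definition C1_functional ::
    "('m::topological_space, 'f::frechet_space) chart set \<Rightarrow> ('m \<Rightarrow> real) \<Rightarrow> bool" where
  "C1_functional A \<phi> \<longleftrightarrow>
     (\<forall>c\<in>A. keller_C1_on (chart_map c ` chart_dom c) (\<phi> \<circ> chart_inv c))"

text \<open>A tangent vector at \<open>x\<close> is a class of pairs (chart at \<open>x\<close>, vector of the model
  space), where two pairs are identified by the derivative of the transition map.\<close>

definition tangent_rel ::
    "('m, 'f::frechet_space) chart set \<Rightarrow> 'm \<Rightarrow>
      ((('m, 'f) chart \<times> 'f) \<times> (('m, 'f) chart \<times> 'f)) set" where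
  "tangent_rel A x =
     {((c, h), (d, k)) |c h d k.
        c \<in> A \<and> d \<in> A \<and> x \<in> chart_dom c \<and> x \<in> chart_dom d \<and>
        k = dir_derivative (chart_map d \<circ> chart_inv c) (chart_map c x) h}"

definition tangent_space ::
    "('m, 'f::frechet_space) chart set \<Rightarrow> 'm \<Rightarrow> (('m, 'f) chart \<times> 'f) set set" where
  "tangent_space A x = ({c \<in> A. x \<in> chart_dom c} \<times> UNIV) // tangent_rel A x"

type_synonym ('m, 'f) tangent = "'m \<times> (('m, 'f) chart \<times> 'f) set"

definition tangent_bundle ::
    "('m, 'f::frechet_space) chart set \<Rightarrow> ('m, 'f) tangent set" where
  "tangent_bundle A = (SIGMA x:UNIV. tangent_space A x)"

definition tangent_triv ::
    "('m, 'f::frechet_space) chart set \<Rightarrow> ('m, 'f) chart \<Rightarrow> 'm \<times> 'f \<Rightarrow> ('m, 'f) tangent" where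
  "tangent_triv A c = (\<lambda>(x, h). (x, tangent_rel A x `` {(c, h)}))"

text \<open>The map $\psi_*(x) : T_xM \to F$ induced by a chart at \<open>x\<close>; the class of a tangent
  vector contains exactly one pair for each chart at \<open>x\<close>.\<close>

definition chart_push :: "('m, 'f) chart \<Rightarrow> (('m, 'f) chart \<times> 'f) set \<Rightarrow> 'f" where
  "chart_push c v = (THE h. (c, h) \<in> v)"

definition tangent_topology ::
    "('m::topological_space, 'f::frechet_space) chart set \<Rightarrow> ('m, 'f) tangent topology" where
  "tangent_topology A =
     topology_generated_by
       {tangent_triv A c ` W |c W. c \<in> A \<and> open W \<and> W \<subseteq> chart_dom c \<times> UNIV}"

definition bundle_chart ::
    "('m::topological_space, 'f::frechet_space) chart set \<Rightarrow> 'm set \<Rightarrow>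
      ('m \<times> 'f \<Rightarrow> ('m, 'f) tangent) \<Rightarrow> bool" where
  "bundle_chart A U \<Psi> \<longleftrightarrow>
     open U \<and>
     homeomorphic_map (top_of_set (U \<times> UNIV))
       (subtopology (tangent_topology A) {v \<in> tangent_bundle A. fst v \<in> U}) \<Psi> \<and>
     (\<forall>x\<in>U. \<forall>h. fst (\<Psi> (x, h)) = x) \<and>
     (\<forall>x\<in>U. \<forall>c\<in>A. x \<in> chart_dom c \<longrightarrow> linear (\<lambda>h. chart_push c (snd (\<Psi> (x, h)))))"


section \<open>Finsler structures\<close>

text \<open>The components are numbered from 0 instead of 1: \<open>N n\<close> stands for
  $\|\cdot\|_{M,n+1}$, which is why the weight in \<open>finsler_metric\<close> is $2^{-(n+1)}$.\<close>

definition finsler_on_trivial_bundle ::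
    "'m::topological_space set \<Rightarrow> (nat \<Rightarrow> 'm \<times> 'f::frechet_space \<Rightarrow> real) \<Rightarrow> bool" where
  "finsler_on_trivial_bundle T N \<longleftrightarrow>
     (\<forall>n. continuous_on (T \<times> UNIV) (N n) \<and> (\<forall>b\<in>T. \<forall>x. 0 \<le> N n (b, x))) \<and>
     (\<forall>b\<in>T. generating_seminorms (\<lambda>n x. N n (b, x))) \<and>
     (\<forall>k>1. \<forall>x0\<in>T. \<exists>W. openin (top_of_set T) W \<and> x0 \<in> W \<and>
        (\<forall>w\<in>W. \<forall>n x. (1 / k) * N n (x0, x) \<le> N n (w, x) \<and> N n (w, x) \<le> k * N n (x0, x)))"

definition graded_finsler_structure ::
    "('m::topological_space, 'f::frechet_space) chart set \<Rightarrow>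
      (nat \<Rightarrow> ('m, 'f) tangent \<Rightarrow> real) \<Rightarrow> bool" where
  "graded_finsler_structure A N \<longleftrightarrow>
     (\<forall>n. continuous_map (subtopology (tangent_topology A) (tangent_bundle A)) euclideanreal (N n)) \<and>
     (\<forall>n. \<forall>v\<in>tangent_bundle A. 0 \<le> N n v) \<and>
     (\<forall>x. \<exists>U \<Psi>. x \<in> U \<and> bundle_chart A U \<Psi> \<and>
        finsler_on_trivial_bundle U (\<lambda>n. N n \<circ> \<Psi>)) \<and>
     (\<forall>n. \<forall>v\<in>tangent_bundle A. N n v \<le> N (Suc n) v)"

definition has_velocity ::
    "('m, 'f::frechet_space) chart set \<Rightarrow> (real \<Rightarrow> 'm) \<Rightarrow> real set \<Rightarrow> real \<Rightarrow>
      (('m, 'f) chart \<times> 'f) set \<Rightarrow> bool" where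
  "has_velocity A g I t v \<longleftrightarrow>
     v \<in> tangent_space A (g t) \<and>
     (\<forall>c\<in>A. g t \<in> chart_dom c \<longrightarrow>
        ((\<lambda>s. (1 / (s - t)) *\<^sub>R (chart_map c (g s) - chart_map c (g t))) \<longlongrightarrow> chart_push c v)
          (at t within I))"

definition velocity ::
    "('m, 'f::frechet_space) chart set \<Rightarrow> (real \<Rightarrow> 'm) \<Rightarrow> real set \<Rightarrow> real \<Rightarrow>
      (('m, 'f) chart \<times> 'f) set" where
  "velocity A g I t = (THE v. has_velocity A g I t v)"

definition C1_curve ::
    "('m::topological_space, 'f::frechet_space) chart set \<Rightarrow> real \<Rightarrow> real \<Rightarrow> (real \<Rightarrow> 'm) \<Rightarrow> bool"
  where
  "C1_curve A a b g \<longleftrightarrow>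
     continuous_on {a..b} g \<and>
     (\<forall>t\<in>{a..b}. \<exists>v. has_velocity A g {a..b} t v) \<and>
     continuous_map (top_of_set {a..b}) (tangent_topology A) (\<lambda>t. (g t, velocity A g {a..b} t))"

text \<open>\<open>P\<close> is the finite set of break points.\<close>

definition piecewise_C1_curve ::
    "('m::topological_space, 'f::frechet_space) chart set \<Rightarrow> real \<Rightarrow> real \<Rightarrow> (real \<Rightarrow> 'm) \<Rightarrow> bool"
  where
  "piecewise_C1_curve A a b g \<longleftrightarrow>
     a < b \<and> continuous_on {a..b} g \<and>
     (\<exists>P. finite P \<and>
        (\<forall>s t. a \<le> s \<and> s < t \<and> t \<le> b \<and> {s<..<t} \<inter> P = {} \<longrightarrow> C1_curve A s t g))"

text \<open>At the finitely many break points the velocity need not exist; they do not affect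
  the integral.\<close>

definition curve_length ::
    "('m, 'f::frechet_space) chart set \<Rightarrow> (nat \<Rightarrow> ('m, 'f) tangent \<Rightarrow> real) \<Rightarrow> nat \<Rightarrow>
      real \<Rightarrow> real \<Rightarrow> (real \<Rightarrow> 'm) \<Rightarrow> real" where
  "curve_length A N n a b g = integral {a..b} (\<lambda>t. N n (g t, velocity A g {a..b} t))"

definition finsler_dist_component ::
    "('m::topological_space, 'f::frechet_space) chart set \<Rightarrow>
      (nat \<Rightarrow> ('m, 'f) tangent \<Rightarrow> real) \<Rightarrow> nat \<Rightarrow> 'm \<Rightarrow> 'm \<Rightarrow> real" where
  "finsler_dist_component A N n x y =
     Inf {curve_length A N n a b g |a b g. piecewise_C1_curve A a b g \<and> g a = x \<and> g b = y}"

definition finsler_metric ::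
    "('m::topological_space, 'f::frechet_space) chart set \<Rightarrow>
      (nat \<Rightarrow> ('m, 'f) tangent \<Rightarrow> real) \<Rightarrow> 'm \<Rightarrow> 'm \<Rightarrow> real" where
  "finsler_metric A N x y =
     (\<Sum>n. (1 / 2 ^ Suc n) *
        (finsler_dist_component A N n x y / (1 + finsler_dist_component A N n x y)))"


section \<open>Critical points and the Palais-Smale condition\<close>

definition local_minimum_point :: "('m::topological_space \<Rightarrow> real) \<Rightarrow> 'm \<Rightarrow> bool" where
  "local_minimum_point \<phi> x \<longleftrightarrow> (\<exists>U. open U \<and> x \<in> U \<and> (\<forall>y\<in>U. \<phi> x \<le> \<phi> y))"

definition critical_point ::
    "('m, 'f::frechet_space) chart set \<Rightarrow> ('m \<Rightarrow> real) \<Rightarrow> 'm \<Rightarrow> bool" where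
  "critical_point A \<phi> x \<longleftrightarrow>
     (\<exists>c\<in>A. x \<in> chart_dom c \<and>
        (\<forall>h. dir_derivative (\<phi> \<circ> chart_inv c) (chart_map c x) h = 0))"

text \<open>$\varphi'(x,h)$ for $h \in T_xM$; for a $C^1$ functional the limit exists in every
  chart at \<open>x\<close> and does not depend on the chart.\<close>

definition functional_derivative ::
    "('m, 'f::frechet_space) chart set \<Rightarrow> ('m \<Rightarrow> real) \<Rightarrow> 'm \<Rightarrow>
      (('m, 'f) chart \<times> 'f) set \<Rightarrow> real" where
  "functional_derivative A \<phi> x v =
     (THE l. \<forall>c\<in>A. x \<in> chart_dom c \<longrightarrow>
        ((\<lambda>t. (\<phi> (chart_inv c (chart_map c x + t *\<^sub>R chart_push c v)) - \<phi> x) / t) \<longlongrightarrow> l) (at 0))"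

definition unit_ball_infty ::
    "('m, 'f::frechet_space) chart set \<Rightarrow> (nat \<Rightarrow> ('m, 'f) tangent \<Rightarrow> real) \<Rightarrow> 'm \<Rightarrow>
      (('m, 'f) chart \<times> 'f) set set" where
  "unit_ball_infty A N x = (\<Inter>n. {v \<in> tangent_space A x. N n (x, v) \<le> 1})"

text \<open>By continuity and linearity of $\varphi'(x,\cdot)$ and since the seminorms generate
  the topology, the infimum is over a nonempty set of reals that is bounded below.\<close>

definition Phi ::
    "('m, 'f::frechet_space) chart set \<Rightarrow> (nat \<Rightarrow> ('m, 'f) tangent \<Rightarrow> real) \<Rightarrow>
      ('m \<Rightarrow> real) \<Rightarrow> 'm \<Rightarrow> real" where
  "Phi A N \<phi> x = (INF v\<in>unit_ball_infty A N x. functional_derivative A \<phi> x v)"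

definition palais_smale ::
    "('m::topological_space, 'f::frechet_space) chart set \<Rightarrow>
      (nat \<Rightarrow> ('m, 'f) tangent \<Rightarrow> real) \<Rightarrow> ('m \<Rightarrow> real) \<Rightarrow> real \<Rightarrow> 'm set \<Rightarrow> bool" where
  "palais_smale A N \<phi> c S \<longleftrightarrow>
     (\<forall>X :: nat \<Rightarrow> 'm.
        (\<forall>i. X i \<in> S) \<and> (\<lambda>i. \<phi> (X i)) \<longlonglongrightarrow> c \<and> (\<lambda>i. Phi A N \<phi> (X i)) \<longlonglongrightarrow> 0 \<longrightarrow>
        (\<exists>l r. strict_mono r \<and> (X \<circ> r) \<longlonglongrightarrow> l))"

end

theory Submission
  imports Defs
begin

text \<open>Suppose that \<open>p\<close> and \<open>q\<close> are the only critical points of \<open>\<phi>\<close>. Closedness of \<open>\<phi>\<close> then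
  forces \<open>M\<close> to be locally compact and \<open>\<phi>\<close> to be proper, and a mountain pass argument with
  components of sublevel sets gives a contradiction.

  All but countably many fibres of a closed continuous real function on a second countable
  Hausdorff space are compact (\<open>countable_noncompact_fibres\<close>). As \<open>\<phi>\<close> is not constant and \<open>M\<close> is
  connected, some compact fibre contains a regular point \<open>x\<close> of \<open>\<phi>\<close>. In a chart at \<open>x\<close> there
  are a convex neighbourhood and a direction along which \<open>\<phi>\<close> strictly increases
  (\<open>keller_C1_monotone_box\<close>); sliding the compact fibre along this direction sweeps out a
  neighbourhood of \<open>x\<close>, so \<open>M\<close> is locally compact
  (\<open>compact_regular_fibre_imp_locally_compact\<close>). A fibre has empty interior, because its interior
  points are critical and \<open>M\<close> has no isolated points; in a locally compact space this makes every
  fibre compact (\<open>compact_fibres_if_empty_interior\<close>), and a closed map with compact fibres is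
  proper.

  Let \<open>\<phi> q \<le> \<phi> p\<close>. The minimum at \<open>p\<close> is strict, so for \<open>a\<close> slightly above \<open>\<phi> p\<close> the component of
  \<open>p\<close> in \<open>{\<phi> < a}\<close> is trapped near \<open>p\<close>. Let these components grow as long as they avoid \<open>q\<close>
  and \<open>\<phi> \<ge> \<phi> p\<close> holds on them, up to a level \<open>c\<close>. Their union has a compact closure, by
  properness, and the points of level \<open>c\<close> on its frontier are regular. Near a regular point the
  part of \<open>{\<phi> < c}\<close> lies in a single component (\<open>regular_sublevel_connected\<close>), so nothing new is
  met at level \<open>c\<close> and the components can grow past it (\<open>proper_mountain_pass\<close>).\<close>

section \<open>Frechet spaces as topological vector spaces\<close>

lemma seminorm_minus_commute:
  assumes "seminorm p" shows "p (x - y) = p (y - x)"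
proof -
  have "p ((- 1) *\<^sub>R (y - x)) = \<bar>- 1\<bar> * p (y - x)"
    using assms unfolding seminorm_def by blast
  then show ?thesis by simp
qed

lemma seminorm_zero:
  assumes "seminorm p" shows "p 0 = 0"
proof -
  have "p (0 *\<^sub>R 0) = \<bar>0\<bar> * p 0"
    using assms unfolding seminorm_def by blast
  then show ?thesis by simp
qed

lemma seminorm_triangle:
  assumes "seminorm p" shows "p (x - z) \<le> p (x - y) + p (y - z)"
proof -
  have "p ((x - y) + (y - z)) \<le> p (x - y) + p (y - z)"
    using assms unfolding seminorm_def by blast
  then show ?thesis by simp
qed

lemma seminorm_nonneg:
  assumes "seminorm p" shows "0 \<le> p x"
  using seminorm_triangle[OF assms, of 0 0 x] seminorm_minus_commute[OF assms, of 0 x]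
    seminorm_zero[OF assms] by simp

lemma generating_seminorms_ball:
  fixes p :: "nat \<Rightarrow> 'a::frechet_space \<Rightarrow> real"
  assumes p: "generating_seminorms p"
  shows "open {y. \<forall>i\<le>n. p i (y - x) < e}" and "convex {y. \<forall>i\<le>n. p i (y - x) < e}"
proof -
  have sn: "seminorm (p i)" for i
    using p unfolding generating_seminorms_def by blast
  show "open {y. \<forall>i\<le>n. p i (y - x) < e}"
  proof -
    have "\<exists>m d. d > 0 \<and> {z. \<forall>i\<le>m. p i (z - y) < d} \<subseteq> {y. \<forall>i\<le>n. p i (y - x) < e}"
      if y: "\<forall>i\<le>n. p i (y - x) < e" for y
    proof -
      define d where "d = Min ((\<lambda>i. e - p i (y - x)) ` {..n})"
      have "d > 0"
        unfolding d_def using y by (subst Min_gr_iff) auto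
      moreover have "p i (z - x) < e" if "\<forall>i\<le>n. p i (z - y) < d" "i \<le> n" for z i
      proof -
        have "d \<le> e - p i (y - x)"
          unfolding d_def using that by (intro Min_le) auto
        then show ?thesis
          using that seminorm_triangle[OF sn, of i z x y] by fastforce
      qed
      ultimately show ?thesis by blast
    qed
    then show ?thesis
      using p unfolding generating_seminorms_def by auto
  qed
  show "convex {y. \<forall>i\<le>n. p i (y - x) < e}"
    unfolding convex_alt
  proof (intro ballI allI impI, simp, intro allI impI)
    fix a b :: 'a and u :: real and i
    assume a: "\<forall>i\<le>n. p i (a - x) < e" and b: "\<forall>i\<le>n. p i (b - x) < e"
      and u: "0 \<le> u \<and> u \<le> 1" and i: "i \<le> n"
    have "p i ((1 - u) *\<^sub>R a + u *\<^sub>R b - x) = p i ((1 - u) *\<^sub>R (a - x) + u *\<^sub>R (b - x))"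
      by (simp add: algebra_simps)
    also have "\<dots> \<le> p i ((1 - u) *\<^sub>R (a - x)) + p i (u *\<^sub>R (b - x))"
      using sn[of i] unfolding seminorm_def by blast
    also have "\<dots> = \<bar>1 - u\<bar> * p i (a - x) + \<bar>u\<bar> * p i (b - x)"
      using sn[of i] unfolding seminorm_def by simp
    also have "\<dots> = (1 - u) * p i (a - x) + u * p i (b - x)"
      using u by simp
    also have "\<dots> < e"
      using convex_bound_lt[of "p i (a - x)" e "p i (b - x)" "1 - u" u] a b u i by simp
    finally show "p i ((1 - u) *\<^sub>R a + u *\<^sub>R b - x) < e" .
  qed
qed

lemma frechet_tendsto_iff:
  fixes p :: "nat \<Rightarrow> 'a::frechet_space \<Rightarrow> real"
  assumes p: "generating_seminorms p"
  shows "(f \<longlongrightarrow> l) F \<longleftrightarrow> (\<forall>i. ((\<lambda>x. p i (f x - l)) \<longlongrightarrow> 0) F)"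
proof
  have sn: "seminorm (p i)" for i
    using p unfolding generating_seminorms_def by blast
  {
    assume L: "(f \<longlongrightarrow> l) F"
    show "\<forall>i. ((\<lambda>x. p i (f x - l)) \<longlongrightarrow> 0) F"
    proof (intro allI tendstoI)
      fix i and e :: real assume "e > 0"
      then have "\<forall>\<^sub>F x in F. f x \<in> {y. \<forall>j\<le>i. p j (y - l) < e}"
        using topological_tendstoD[OF L generating_seminorms_ball(1)[OF p]] seminorm_zero[OF sn]
        by simp
      then show "\<forall>\<^sub>F x in F. dist (p i (f x - l)) 0 < e"
        by eventually_elim (simp add: seminorm_nonneg[OF sn])
    qed
  next
    assume R: "\<forall>i. ((\<lambda>x. p i (f x - l)) \<longlongrightarrow> 0) F"
    show "(f \<longlongrightarrow> l) F"
    proof (rule topological_tendstoI)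
      fix S assume "open S" "l \<in> S"
      then obtain n e where "e > 0" and sub: "{y. \<forall>i\<le>n. p i (y - l) < e} \<subseteq> S"
        using p unfolding generating_seminorms_def by blast
      have "\<forall>i\<in>{..n}. \<forall>\<^sub>F x in F. p i (f x - l) < e"
        using R \<open>e > 0\<close> order_tendstoD(2) by blast
      then have "\<forall>\<^sub>F x in F. \<forall>i\<in>{..n}. p i (f x - l) < e"
        by (simp add: eventually_ball_finite)
      then show "\<forall>\<^sub>F x in F. f x \<in> S"
        by eventually_elim (use sub in auto)
    qed
  }
qed

instance frechet_space \<subseteq> topological_ab_group_add
proof
  fix a b :: 'a
  obtain p :: "nat \<Rightarrow> 'a \<Rightarrow> real" where p: "generating_seminorms p"
    using frechet_seminorms by blast
  have sn: "seminorm (p i)" for i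
    using p unfolding generating_seminorms_def by blast
  have lim: "((\<lambda>x. p i (x - c)) \<longlongrightarrow> 0) (nhds c)" for i and c :: 'a
    using frechet_tendsto_iff[OF p, of "\<lambda>x. x" c "nhds c"] filterlim_ident by blast
  show "LIM x (nhds a \<times>\<^sub>F nhds b). fst x + snd x :> nhds (a + b)"
    unfolding frechet_tendsto_iff[OF p]
  proof
    fix i
    have 1: "((\<lambda>x. p i (fst x - a)) \<longlongrightarrow> 0) (nhds a \<times>\<^sub>F nhds b)"
      by (rule filterlim_compose[OF lim filterlim_fst])
    have 2: "((\<lambda>x. p i (snd x - b)) \<longlongrightarrow> 0) (nhds a \<times>\<^sub>F nhds b)"
      by (rule filterlim_compose[OF lim filterlim_snd])
    have le: "p i (fst x + snd x - (a + b)) \<le> p i (fst x - a) + p i (snd x - b)" for x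
    proof -
      have "p i ((fst x - a) + (snd x - b)) \<le> p i (fst x - a) + p i (snd x - b)"
        using sn[of i] unfolding seminorm_def by blast
      then show ?thesis by (simp add: algebra_simps)
    qed
    show "((\<lambda>x. p i (fst x + snd x - (a + b))) \<longlongrightarrow> 0) (nhds a \<times>\<^sub>F nhds b)"
      by (rule tendsto_sandwich[OF _ _ tendsto_const tendsto_add_zero[OF 1 2]])
        (use le seminorm_nonneg[OF sn] in auto)
  qed
  show "(uminus \<longlongrightarrow> - a) (nhds a)"
    unfolding frechet_tendsto_iff[OF p]
  proof
    fix i
    have "p i (- x - - a) = p i (x - a)" for x
      using seminorm_minus_commute[OF sn, of i a x] by simp
    then show "((\<lambda>x. p i (- x - - a)) \<longlongrightarrow> 0) (nhds a)"
      using lim by simp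
  qed
qed

lemma continuous_on_line [continuous_intros]:
  fixes h :: "'a::frechet_space"
  assumes "continuous_on S g"
  shows "continuous_on S (\<lambda>x. g x *\<^sub>R h)"
proof -
  obtain p :: "nat \<Rightarrow> 'a \<Rightarrow> real" where p: "generating_seminorms p"
    using frechet_seminorms by blast
  have sn: "seminorm (p i)" for i
    using p unfolding generating_seminorms_def by blast
  have "((\<lambda>x. g x *\<^sub>R h) \<longlongrightarrow> g a *\<^sub>R h) (at a within S)" if "a \<in> S" for a
    unfolding frechet_tendsto_iff[OF p]
  proof
    fix i
    have "(g \<longlongrightarrow> g a) (at a within S)"
      using assms that by (simp add: continuous_on_def)
    then have "((\<lambda>x. \<bar>g x - g a\<bar> * p i h) \<longlongrightarrow> 0) (at a within S)"
      by (intro tendsto_mult_left_zero tendsto_rabs_zero) (simp add: LIM_zero)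
    moreover have "p i (g x *\<^sub>R h - g a *\<^sub>R h) = \<bar>g x - g a\<bar> * p i h" for x
      using sn[of i] unfolding seminorm_def by (simp flip: scaleR_diff_left)
    ultimately show "((\<lambda>x. p i (g x *\<^sub>R h - g a *\<^sub>R h)) \<longlongrightarrow> 0) (at a within S)"
      by simp
  qed
  then show ?thesis
    by (simp add: continuous_on_def)
qed

lemma frechet_convex_nhd:
  fixes x :: "'a::frechet_space"
  assumes "open S" "x \<in> S"
  obtains B where "open B" "convex B" "x \<in> B" "B \<subseteq> S"
proof -
  obtain p :: "nat \<Rightarrow> 'a \<Rightarrow> real" where p: "generating_seminorms p"
    using frechet_seminorms by blast
  have sn: "seminorm (p i)" for i
    using p unfolding generating_seminorms_def by blast
  obtain n e where "e > 0" "{y. \<forall>i\<le>n. p i (y - x) < e} \<subseteq> S"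
    using p assms unfolding generating_seminorms_def by blast
  then show ?thesis
    using generating_seminorms_ball[OF p, where x = x] seminorm_zero[OF sn]
    by (intro that[of "{y. \<forall>i\<le>n. p i (y - x) < e}"]) simp_all
qed

lemma connected_component_segment:
  fixes u v :: "'a::frechet_space"
  assumes "convex B" "u \<in> B" "v \<in> B"
  shows "connected_component B u v"
proof -
  let ?s = "\<lambda>t. u + t *\<^sub>R (v - u)"
  have "connected (?s ` {0..1})"
    by (intro connected_continuous_image continuous_intros) auto
  moreover have "?s ` {0..1} \<subseteq> B"
  proof clarify
    fix t :: real assume "t \<in> {0..1}"
    then have "(1 - t) *\<^sub>R u + t *\<^sub>R v \<in> B"
      using assms by (auto simp: convex_alt)
    then show "?s t \<in> B" by (simp add: algebra_simps)
  qed
  moreover have "u \<in> ?s ` {0..1}" "v \<in> ?s ` {0..1}"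
    by (force intro: image_eqI[of _ _ 0], force intro: image_eqI[of _ _ 1])
  ultimately show ?thesis
    unfolding connected_component_def by blast
qed

section \<open>Keller differentiable functions along a line\<close>

lemma dir_derivative_eqI:
  "has_dir_derivative f x h l \<Longrightarrow> dir_derivative f x h = l"
  unfolding dir_derivative_def has_dir_derivative_def
  by (rule the_equality) (auto intro: tendsto_unique[OF trivial_limit_at])

lemma keller_C1_has_dir_derivative:
  assumes "keller_C1_on U f" "x \<in> U"
  shows "has_dir_derivative f x h (dir_derivative f x h)"
  using assms dir_derivative_eqI unfolding keller_C1_on_def by metis

lemma keller_C1_derivative_mem:
  assumes "keller_C1_on U f" "x \<in> U"
  shows "dir_derivative f x \<in> continuous_linear_maps"
proof -
  have "dir_derivative f x \<in> topspace compact_open_topology"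
    using assms continuous_map_image_subset_topspace unfolding keller_C1_on_def
    by fastforce
  then show ?thesis
    unfolding compact_open_topology_def topology_generated_by_topspace by blast
qed

text \<open>The subbasic open set given by the compact set \<open>{h}\<close> and the positive half-line.\<close>

lemma keller_C1_open_derivative_pos:
  fixes f :: "'e::frechet_space \<Rightarrow> real"
  assumes f: "keller_C1_on U f"
  shows "open {x \<in> U. 0 < dir_derivative f x h}"
proof -
  let ?G = "{T \<in> continuous_linear_maps. T ` {h} \<subseteq> {0<..}} :: ('e \<Rightarrow> real) set"
  have "\<exists>K V. ?G = {T \<in> continuous_linear_maps. T ` K \<subseteq> V} \<and> compact K \<and> open V"
    by (rule exI[of _ "{h}"], rule exI[of _ "{0<..}"]) simp
  then have "openin compact_open_topology ?G"
    unfolding compact_open_topology_def by (intro topology_generated_by_Basis) blast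
  then have "openin (top_of_set U) {x \<in> topspace (top_of_set U). dir_derivative f x \<in> ?G}"
    using f unfolding keller_C1_on_def by (blast intro: openin_continuous_map_preimage)
  moreover have "{x \<in> topspace (top_of_set U). dir_derivative f x \<in> ?G} =
      {x \<in> U. 0 < dir_derivative f x h}"
    using keller_C1_derivative_mem[OF f] by auto
  ultimately show ?thesis
    using f openin_open_trans unfolding keller_C1_on_def by metis
qed

lemma has_dir_derivative_along_line:
  fixes f :: "'e::frechet_space \<Rightarrow> real"
  assumes "has_dir_derivative f (x + t *\<^sub>R h) h l"
  shows "((\<lambda>t. f (x + t *\<^sub>R h)) has_real_derivative l) (at t)"
  using assms unfolding has_dir_derivative_def DERIV_def
  by (simp add: scaleR_add_left add.assoc)

lemma keller_C1_local_min:
  fixes f :: "'e::frechet_space \<Rightarrow> real"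
  assumes f: "keller_C1_on U f" and V: "open V" "x \<in> V" "V \<subseteq> U"
    and min: "\<And>y. y \<in> V \<Longrightarrow> f x \<le> f y"
  shows "dir_derivative f x h = 0"
proof -
  let ?g = "\<lambda>t. f (x + t *\<^sub>R h)"
  have "has_dir_derivative f x h (dir_derivative f x h)"
    using f V by (auto intro: keller_C1_has_dir_derivative)
  then have d: "DERIV ?g 0 :> dir_derivative f x h"
    using has_dir_derivative_along_line[of f x 0 h] by simp
  have "open ((\<lambda>t. x + t *\<^sub>R h) -` V)"
    by (intro open_vimage V continuous_intros)
  then obtain r where "r > 0" "ball 0 r \<subseteq> (\<lambda>t. x + t *\<^sub>R h) -` V"
    using V(2) openE[of _ 0] by force
  then have "\<forall>y. \<bar>0 - y\<bar> < r \<longrightarrow> ?g 0 \<le> ?g y"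
    using min by (auto simp: subset_eq dist_real_def)
  then show ?thesis
    using DERIV_local_min[OF d \<open>r > 0\<close>] by blast
qed

text \<open>Near a regular point the function is strictly increasing along all short segments
  parallel to some vector \<open>h\<close>. Besides linearity of the derivative at \<open>x\<close>, only its
  continuity in one fixed direction enters, so no implicit function theorem is involved.\<close>

lemma keller_C1_monotone_box:
  fixes f :: "'e::frechet_space \<Rightarrow> real"
  assumes f: "keller_C1_on U f" and V: "open V" "x \<in> V" "V \<subseteq> U"
    and nz: "dir_derivative f x k \<noteq> 0"
  obtains B h s where "open B" "convex B" "x \<in> B" "0 < s"
    "\<And>b t. b \<in> B \<Longrightarrow> \<bar>t\<bar> \<le> s \<Longrightarrow> b + t *\<^sub>R h \<in> V"
    "\<And>b t t'. b \<in> B \<Longrightarrow> - s \<le> t \<Longrightarrow> t < t' \<Longrightarrow> t' \<le> s \<Longrightarrow> f (b + t *\<^sub>R h) < f (b + t' *\<^sub>R h)"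
    "\<And>b. b \<in> B \<Longrightarrow> f (b + (- s) *\<^sub>R h) < f x"
    "\<And>b. b \<in> B \<Longrightarrow> f x < f (b + s *\<^sub>R h)"
proof -
  have lin: "linear (dir_derivative f x)"
    using keller_C1_derivative_mem[OF f] V unfolding continuous_linear_maps_def by blast
  obtain h where h: "0 < dir_derivative f x h"
    using nz linear_neg[OF lin, of k] by (metis neg_0_less_iff_less linorder_neqE_linordered_idom)
  define G where "G = V \<inter> {y \<in> U. 0 < dir_derivative f y h}"
  have G: "open G" "x \<in> G"
    unfolding G_def using keller_C1_open_derivative_pos[OF f] V h by auto
  have contf: "continuous_on U f"
    using f unfolding keller_C1_on_def by blast
  obtain p :: "nat \<Rightarrow> 'e \<Rightarrow> real" where p: "generating_seminorms p"
    using frechet_seminorms by blast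
  have sn: "seminorm (p i)" for i
    using p unfolding generating_seminorms_def by blast
  obtain n e where e: "e > 0" and sub: "{y. \<forall>i\<le>n. p i (y - x) < e} \<subseteq> G"
    using p G unfolding generating_seminorms_def by blast
  \<comment> \<open>\<open>s\<close> is so small that \<open>p i (t *\<^sub>R h) \<le> e / 2\<close> for \<open>i \<le> n\<close> and \<open>\<bar>t\<bar> \<le> s\<close>;
    the 1 in the maximum avoids a division by zero.\<close>
  define C where "C = Max (insert 1 ((\<lambda>i. p i h) ` {..n}))"
  have C: "1 \<le> C" "\<And>i. i \<le> n \<Longrightarrow> p i h \<le> C"
    unfolding C_def by (intro Max_ge; force)+
  define s where "s = e / (2 * C)"
  have s: "0 < s" "s * C = e / 2"
    unfolding s_def using e C by auto
  define B1 where "B1 = {y. \<forall>i\<le>n. p i (y - x) < e / 2}"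
  have inG: "b + t *\<^sub>R h \<in> G" if "b \<in> B1" "\<bar>t\<bar> \<le> s" for b t
  proof -
    have "p i (b + t *\<^sub>R h - x) < e" if "i \<le> n" for i
    proof -
      have "p i ((b - x) + t *\<^sub>R h) \<le> p i (b - x) + p i (t *\<^sub>R h)"
        using sn[of i] unfolding seminorm_def by blast
      also have "p i (t *\<^sub>R h) = \<bar>t\<bar> * p i h"
        using sn[of i] unfolding seminorm_def by blast
      also have "\<bar>t\<bar> * p i h \<le> s * C"
        using \<open>\<bar>t\<bar> \<le> s\<close> C that seminorm_nonneg[OF sn] by (intro mult_mono) auto
      also have "p i (b - x) < e / 2"
        using \<open>b \<in> B1\<close> that unfolding B1_def by blast
      finally show ?thesis using s by (simp add: algebra_simps)
    qed
    then show ?thesis using sub by blast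
  qed
  have mono: "f (b + t *\<^sub>R h) < f (b + t' *\<^sub>R h)"
    if b: "b \<in> B1" and t: "- s \<le> t" "t < t'" "t' \<le> s" for b t t'
  proof (rule DERIV_pos_imp_increasing[OF t(2)])
    fix r assume "t \<le> r" "r \<le> t'"
    then have "b + r *\<^sub>R h \<in> G"
      using inG[OF b] t by auto
    then show "\<exists>y. ((\<lambda>t. f (b + t *\<^sub>R h)) has_real_derivative y) (at r) \<and> 0 < y"
      using keller_C1_has_dir_derivative[OF f] has_dir_derivative_along_line
      unfolding G_def by blast
  qed
  have xB1: "x \<in> B1"
    unfolding B1_def using e seminorm_zero[OF sn] by simp
  have contV: "continuous_on V f"
    using contf V(3) continuous_on_subset by blast
  have opn: "open ((\<lambda>b. b + r *\<^sub>R h) -` (V \<inter> f -` W))" if "open W" for r W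
    using continuous_open_preimage[OF contV V(1) that]
    by (intro open_vimage) (auto intro!: continuous_intros)
  define G2 where "G2 = B1 \<inter> ((\<lambda>b. b + (- s) *\<^sub>R h) -` (V \<inter> f -` {..<f x})) \<inter>
    ((\<lambda>b. b + s *\<^sub>R h) -` (V \<inter> f -` {f x<..}))"
  have "open G2"
    unfolding G2_def B1_def by (intro open_Int opn generating_seminorms_ball[OF p]) auto
  moreover have "x \<in> G2"
  proof -
    have "f (x + (- s) *\<^sub>R h) < f (x + 0 *\<^sub>R h)" "f (x + 0 *\<^sub>R h) < f (x + s *\<^sub>R h)"
      using mono[OF xB1, of "- s" 0] mono[OF xB1, of 0 s] \<open>0 < s\<close> by simp_all
    moreover have "x + (- s) *\<^sub>R h \<in> G" "x + s *\<^sub>R h \<in> G"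
      using inG[OF xB1, of "- s"] inG[OF xB1, of s] \<open>0 < s\<close> by simp_all
    ultimately show ?thesis
      unfolding G2_def using xB1 by (simp add: G_def)
  qed
  ultimately obtain B where B: "open B" "convex B" "x \<in> B" "B \<subseteq> G2"
    using frechet_convex_nhd by blast
  have BB: "b \<in> B1" "f (b + (- s) *\<^sub>R h) < f x" "f x < f (b + s *\<^sub>R h)" if "b \<in> B" for b
    using B(4) that unfolding G2_def by auto
  have "b + t *\<^sub>R h \<in> V" if "b \<in> B" "\<bar>t\<bar> \<le> s" for b t
    using inG[OF BB(1)] that unfolding G_def by blast
  with BB mono show ?thesis
    by (intro that[OF B(1-3) s(1), of h]) auto
qed

section \<open>Fibres of closed maps\<close>

text \<open>If a sequence off the fibre, with values tending to \<open>c\<close>, left every finite union of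
  members of the cover, then its range would have no accumulation point on the fibre, and its
  closure would have an image that misses the limit \<open>c\<close>. The fibre itself need not lie in the
  finite union.\<close>

lemma closed_map_fibre_cover:
  fixes \<phi> :: "'m::t1_space \<Rightarrow> real"
  assumes closed: "closed_map euclidean euclidean \<phi>"
    and D: "countable \<D>" "\<And>W. W \<in> \<D> \<Longrightarrow> open W" and cover: "{x. \<phi> x = c} \<subseteq> \<Union>\<D>"
  obtains F e where "finite F" "F \<subseteq> \<D>" "0 < e"
    "\<And>y. 0 < \<bar>\<phi> y - c\<bar> \<Longrightarrow> \<bar>\<phi> y - c\<bar> < e \<Longrightarrow> y \<in> \<Union>F"
proof (rule ccontr)
  assume no: "\<not> thesis"
  \<comment> \<open>The empty set is added so that the enumeration exists even for an empty cover.\<close>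
  define W where "W = from_nat_into (insert {} \<D>)"
  have W: "range W = insert {} \<D>"
    unfolding W_def by (rule range_from_nat_into) (use D(1) in auto)
  have openW: "open (W n)" for n
    using W D(2) by (metis insertE open_empty rangeI)
  have "\<exists>y. 0 < \<bar>\<phi> y - c\<bar> \<and> \<bar>\<phi> y - c\<bar> < inverse (real (Suc n)) \<and> y \<notin> (\<Union>i\<le>n. W i)" for n
  proof (rule ccontr)
    assume *: "\<not> ?thesis"
    have "y \<in> (\<Union>i\<le>n. W i)" if "0 < \<bar>\<phi> y - c\<bar>" "\<bar>\<phi> y - c\<bar> < inverse (real (Suc n))" for y
      using * that by blast
    then have "y \<in> \<Union>(W ` {..n} - {{}})" if "0 < \<bar>\<phi> y - c\<bar>" "\<bar>\<phi> y - c\<bar> < inverse (real (Suc n))" for y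
      using that by blast
    moreover have "W ` {..n} - {{}} \<subseteq> \<D>" using W by blast
    ultimately have thesis
      by (intro that[of "W ` {..n} - {{}}" "inverse (real (Suc n))"]) auto
    with no show False by blast
  qed
  then obtain y where y: "\<And>n. 0 < \<bar>\<phi> (y n) - c\<bar>" "\<And>n. \<bar>\<phi> (y n) - c\<bar> < inverse (real (Suc n))"
      "\<And>n. y n \<notin> (\<Union>i\<le>n. W i)"
    by metis
  have "(\<lambda>n. \<phi> (y n) - c) \<longlonglongrightarrow> 0"
  proof (rule tendsto_0_le[OF LIMSEQ_inverse_real_of_nat, of _ 1], rule always_eventually, rule allI)
    show "norm (\<phi> (y n) - c) \<le> norm (inverse (real (Suc n))) * 1" for n
      using y(2)[of n] by simp
  qed
  then have lim: "(\<lambda>n. \<phi> (y n)) \<longlonglongrightarrow> c"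
    by (rule LIM_zero_cancel)
  have "closed (\<phi> ` closure (range y))"
    using closed unfolding closed_map_def by (simp flip: closed_closedin)
  moreover have "\<phi> (y n) \<in> \<phi> ` closure (range y)" for n
    using closure_subset[of "range y"] by auto
  ultimately have "c \<in> \<phi> ` closure (range y)"
    using closed_sequentially[OF _ _ lim] by blast
  then obtain z where z: "z \<in> closure (range y)" "\<phi> z = c" by blast
  then have "z \<in> \<Union>(range W)" using cover W by auto
  then obtain n where n: "z \<in> W n" by blast
  have "open (W n - y ` {..<n})"
    by (intro open_Diff openW finite_imp_closed) auto
  moreover have "z \<in> W n - y ` {..<n}"
    using n z(2) y(1) by force
  ultimately have "range y \<inter> (W n - y ` {..<n}) \<noteq> {}"
    using z(1) by (meson closure_iff_nhds_not_empty subset_refl)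
  then obtain m where m: "y m \<in> W n" "y m \<notin> y ` {..<n}"
    by blast
  then have "n \<le> m" by (metis imageI lessThan_iff not_le)
  then show False
    using y(3)[of m] m(1) by blast
qed

text \<open>If the fibre over \<open>c\<close> is not compact, some cover of it by basic open sets has no finite
  subcover, yet some finite subfamily, with union \<open>U\<close>, covers all fibres over a punctured
  neighbourhood of \<open>c\<close>. Hence \<open>c\<close> is isolated among the levels whose fibre is not inside \<open>U\<close>,
  and there are only countably many such \<open>U\<close>. No separation property beyond Hausdorff is
  used; a Frechet manifold need not be regular.\<close>

lemma countable_noncompact_fibres:
  fixes \<phi> :: "'m::{t2_space, second_countable_topology} \<Rightarrow> real"
  assumes closed: "closed_map euclidean euclidean \<phi>"
  shows "countable {c. \<not> compact {x. \<phi> x = c}}"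
proof -
  obtain \<B> :: "'m set set" where \<B>: "countable \<B>" "topological_basis \<B>"
    using ex_countable_basis by blast
  define \<U> where "\<U> = Union ` {F. finite F \<and> F \<subseteq> \<B>}"
  \<comment> \<open>The only level in the rational interval between \<open>r1\<close> and \<open>r2\<close> whose fibre leaves \<open>U\<close>.\<close>
  define lone where "lone = (\<lambda>(U, r1, r2). THE c. r1 < c \<and> c < r2 \<and> \<not> {x. \<phi> x = c} \<subseteq> U)"
  have "c \<in> lone ` (\<U> \<times> \<rat> \<times> \<rat>)" if c: "\<not> compact {x. \<phi> x = c}" for c
  proof -
    obtain \<C> where \<C>: "\<forall>U\<in>\<C>. open U" "{x. \<phi> x = c} \<subseteq> \<Union>\<C>"
      and no: "\<And>D. finite D \<Longrightarrow> D \<subseteq> \<C> \<Longrightarrow> \<not> {x. \<phi> x = c} \<subseteq> \<Union>D"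
      using c unfolding compact_eq_Heine_Borel by meson
    define \<D> where "\<D> = {B \<in> \<B>. \<exists>U\<in>\<C>. B \<subseteq> U}"
    have \<D>: "countable \<D>" "\<D> \<subseteq> \<B>"
      using \<B>(1) unfolding \<D>_def by auto
    have cov: "{x. \<phi> x = c} \<subseteq> \<Union>\<D>"
    proof
      fix x assume "x \<in> {x. \<phi> x = c}"
      then obtain U where U: "U \<in> \<C>" "x \<in> U" using \<C>(2) by blast
      then obtain B where "B \<in> \<B>" "x \<in> B" "B \<subseteq> U"
        using \<C>(1) topological_basisE[OF \<B>(2), of U x] by metis
      then show "x \<in> \<Union>\<D>" using U unfolding \<D>_def by blast
    qed
    have "open W" if "W \<in> \<D>" for W
      using that \<D>(2) topological_basis_open[OF \<B>(2)] by blast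
    then obtain F e where F: "finite F" "F \<subseteq> \<D>" and e: "0 < e"
      and ne: "\<And>y. 0 < \<bar>\<phi> y - c\<bar> \<Longrightarrow> \<bar>\<phi> y - c\<bar> < e \<Longrightarrow> y \<in> \<Union>F"
      using closed_map_fibre_cover[OF closed \<D>(1) _ cov] by metis
    define U where "U = \<Union>F"
    have "U \<in> \<U>"
      unfolding U_def \<U>_def using F \<D>(2) by blast
    have notU: "\<not> {x. \<phi> x = c} \<subseteq> U"
    proof
      assume sub: "{x. \<phi> x = c} \<subseteq> U"
      have "\<forall>B\<in>F. \<exists>V. V \<in> \<C> \<and> B \<subseteq> V"
        using F(2) unfolding \<D>_def by blast
      then obtain V where V: "\<And>B. B \<in> F \<Longrightarrow> V B \<in> \<C> \<and> B \<subseteq> V B"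
        by metis
      have "finite (V ` F)" "V ` F \<subseteq> \<C>"
        using V F(1) by auto
      moreover have "{x. \<phi> x = c} \<subseteq> \<Union>(V ` F)"
        using sub V unfolding U_def by fastforce
      ultimately show False using no by blast
    qed
    obtain r1 where r1: "r1 \<in> \<rat>" "c - e < r1" "r1 < c"
      using Rats_dense_in_real[of "c - e" c] e by auto
    obtain r2 where r2: "r2 \<in> \<rat>" "c < r2" "r2 < c + e"
      using Rats_dense_in_real[of c "c + e"] e by auto
    have "{x. \<phi> x = c'} \<subseteq> U" if "r1 < c'" "c' < r2" "c' \<noteq> c" for c'
      using ne that r1 r2 unfolding U_def by fastforce
    then have "lone (U, r1, r2) = c"
      unfolding lone_def prod.case using r1 r2 notU by (intro the_equality) auto
    then show ?thesis
      using \<open>U \<in> \<U>\<close> r1(1) r2(1) by (metis SigmaI image_eqI)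
  qed
  then have "{c. \<not> compact {x. \<phi> x = c}} \<subseteq> lone ` (\<U> \<times> \<rat> \<times> \<rat>)" by blast
  moreover have "countable (lone ` (\<U> \<times> \<rat> \<times> \<rat>))"
    unfolding \<U>_def using \<B>(1)
    by (intro countable_image countable_SIGMA countable_rat countable_Collect_finite_subset) auto
  ultimately show ?thesis
    using countable_subset by blast
qed

lemma compact_closed_subset: "compact K \<Longrightarrow> closed S \<Longrightarrow> S \<subseteq> K \<Longrightarrow> compact S"
  using compact_Int_closed[of K S] by (simp add: Int_absorb1)

lemma Hausdorff_space_euclidean_t2: "Hausdorff_space (euclidean :: 'm::t2_space topology)"
  unfolding Hausdorff_space_def using hausdorff by (auto simp: disjnt_def)

lemma compact_nhd_in_open:
  fixes E :: "'m::t2_space set"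
  assumes "compact E" "open V" "x \<in> V"
  obtains W C where "open W" "x \<in> W" "compact C" "C \<subseteq> E \<inter> V" "E \<inter> W \<subseteq> C"
proof -
  have "compact (E - V)"
    using assms(1,2) by (simp add: compact_diff)
  then obtain W W' where "open W" "open W'" "{x} \<subseteq> W" "E - V \<subseteq> W'" "disjnt W W'"
    using Hausdorff_space_compact_separation[OF Hausdorff_space_euclidean_t2, of "{x}" "E - V"] assms(3)
    by (auto simp: disjnt_def)
  then show ?thesis
    using assms(1) by (intro that[of W "E - W'"]) (auto simp: disjnt_iff compact_diff)
qed

lemma locally_compact_nhd:
  fixes C :: "'m::t2_space set"
  assumes lc: "locally_compact_space (euclidean :: 'm topology)"
    and C: "compact C" "open N" "C \<subseteq> N"
  obtains G where "open G" "C \<subseteq> G" "compact (closure G)" "closure G \<subseteq> N"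
proof -
  obtain U L where U: "open U" "compact L" "C \<subseteq> U" "U \<subseteq> L"
    using lc C(1) locally_compact_space_compact_closed_compact[of "euclidean :: 'm topology",
        OF disjI1[OF Hausdorff_space_euclidean_t2]]
    by (auto simp flip: open_openin closed_closedin)
  have "compact (L - N)"
    using U C(2) by (simp add: compact_diff)
  then obtain V W where V: "open V" "open W" "C \<subseteq> V" "L - N \<subseteq> W" "disjnt V W"
    using Hausdorff_space_compact_separation[OF Hausdorff_space_euclidean_t2, of C "L - N"] C
    by (auto simp: disjnt_iff)
  have "U \<inter> V \<subseteq> L - W"
    using U V by (auto simp: disjnt_iff)
  moreover have "closed (L - W)"
    using U V compact_imp_closed by blast
  ultimately have sub: "closure (U \<inter> V) \<subseteq> L - W"
    using closure_minimal by blast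
  have "compact (closure (U \<inter> V))"
    using sub U(2) compact_closed_subset closed_closure by blast
  then show ?thesis
    using U V sub by (intro that[of "U \<inter> V"]) auto
qed

lemma compact_fibres_if_empty_interior:
  fixes \<phi> :: "'m::{t2_space, second_countable_topology} \<Rightarrow> real"
  assumes cont: "continuous_on UNIV \<phi>" and closed: "closed_map euclidean euclidean \<phi>"
    and lc: "locally_compact_space (euclidean :: 'm topology)"
    and int: "interior {x. \<phi> x = c} = {}"
  shows "compact {x. \<phi> x = c}"
proof -
  obtain \<B> :: "'m set set" where \<B>: "countable \<B>" "topological_basis \<B>"
    using ex_countable_basis by blast
  define \<D> where "\<D> = {B \<in> \<B>. compact (closure B)}"
  have "\<exists>B\<in>\<D>. x \<in> B" for x
  proof -
    obtain G where G: "open G" "x \<in> G" "compact (closure G)"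
      by (rule locally_compact_nhd[OF lc, of "{x}" UNIV]) auto
    obtain B where B: "B \<in> \<B>" "x \<in> B" "B \<subseteq> G"
      using topological_basisE[OF \<B>(2) G(1,2)] by metis
    then have "compact (closure B)"
      using compact_closed_subset[OF G(3) closed_closure closure_mono] by blast
    then show ?thesis using B unfolding \<D>_def by blast
  qed
  then have cov: "{x. \<phi> x = c} \<subseteq> \<Union>\<D>" by blast
  have "countable \<D>" "\<And>W. W \<in> \<D> \<Longrightarrow> open W"
    using \<B>(1) topological_basis_open[OF \<B>(2)] unfolding \<D>_def by auto
  then obtain F e where F: "finite F" "F \<subseteq> \<D>" and e: "0 < e"
    and ne: "\<And>y. 0 < \<bar>\<phi> y - c\<bar> \<Longrightarrow> \<bar>\<phi> y - c\<bar> < e \<Longrightarrow> y \<in> \<Union>F"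
    using closed_map_fibre_cover[OF closed _ _ cov] by metis
  define K where "K = (\<Union>W\<in>F. closure W)"
  have K: "compact K"
    unfolding K_def using F unfolding \<D>_def by (intro compact_UN) auto
  have "{x. \<phi> x = c} \<subseteq> K"
  proof (rule ccontr)
    assume "\<not> {x. \<phi> x = c} \<subseteq> K"
    then obtain x where x: "\<phi> x = c" "x \<notin> K" by blast
    define G\<^sub>x where "G\<^sub>x = (- K) \<inter> \<phi> -` {c - e <..< c + e}"
    have G\<^sub>x: "open G\<^sub>x"
      unfolding G\<^sub>x_def using compact_imp_closed[OF K] cont by (intro open_Int open_vimage) auto
    have "\<not> G\<^sub>x \<subseteq> {x. \<phi> x = c}"
    proof
      assume "G\<^sub>x \<subseteq> {x. \<phi> x = c}"
      then have "G\<^sub>x \<subseteq> {}" using interior_maximal[OF _ G\<^sub>x] int by metis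
      moreover have "x \<in> G\<^sub>x" using x e unfolding G\<^sub>x_def by simp
      ultimately show False by blast
    qed
    then obtain y where "y \<in> G\<^sub>x" "\<phi> y \<noteq> c" by blast
    then have "y \<in> \<Union>F"
      unfolding G\<^sub>x_def by (intro ne) auto
    then show False
      using \<open>y \<in> G\<^sub>x\<close> closure_subset unfolding G\<^sub>x_def K_def by blast
  qed
  moreover have "closed {x. \<phi> x = c}"
    using closed_vimage[OF closed_singleton cont, of c] by (simp add: vimage_def)
  ultimately show ?thesis
    using K compact_closed_subset by blast
qed

lemma closed_map_compact_fibres_preimage:
  fixes \<phi> :: "'m::t2_space \<Rightarrow> real"
  assumes "closed_map euclidean euclidean \<phi>" "\<And>c. compact {x. \<phi> x = c}" "compact K"
  shows "compact (\<phi> -` K)"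
proof -
  have "proper_map euclidean euclidean \<phi>"
    using assms by (simp add: proper_map_def)
  then show ?thesis
    using compactin_proper_map_preimage[of euclidean euclidean \<phi> K] assms(3)
    by (simp add: vimage_def)
qed

section \<open>Components of sublevel sets\<close>

text \<open>A compact set surrounded by strictly higher values traps the component of \<open>p\<close> in
  slightly higher sublevel sets: the frontier of a relatively compact open set between \<open>C\<close> and
  \<open>N\<close> is compact, so the function is bounded away from \<open>c\<close> on it.\<close>

lemma sublevel_component_trapped:
  fixes \<phi> :: "'m::t2_space \<Rightarrow> real"
  assumes lc: "locally_compact_space (euclidean :: 'm topology)"
    and cont: "continuous_on UNIV \<phi>"
    and C: "compact C" "p \<in> C" "C \<subseteq> N" "open N"
    and above: "\<And>y. y \<in> N \<Longrightarrow> y \<notin> C \<Longrightarrow> c < \<phi> y"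
  obtains a where "c < a" "connected_component_set {x. \<phi> x < a} p \<subseteq> N"
proof -
  obtain G where G: "open G" "C \<subseteq> G" "compact (closure G)" "closure G \<subseteq> N"
    using locally_compact_nhd[OF lc C(1,4,3)] by metis
  define K where "K = closure G - G"
  have K: "compact K"
    unfolding K_def using G by (simp add: compact_diff)
  have aboveK: "c < \<phi> y" if "y \<in> K" for y
    using that above[of y] G unfolding K_def by blast
  have "\<exists>a>c. \<forall>y\<in>K. a \<le> \<phi> y"
  proof (cases "K = {}")
    case True
    then show ?thesis by (intro exI[of _ "c + 1"]) simp
  next
    case False
    then obtain y where "y \<in> K" "\<forall>z\<in>K. \<phi> y \<le> \<phi> z"
      using continuous_attains_inf[OF K _ continuous_on_subset[OF cont subset_UNIV]] by blast
    then show ?thesis using aboveK by blast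
  qed
  then obtain a where a: "c < a" "\<forall>y\<in>K. a \<le> \<phi> y" by blast
  define T where "T = connected_component_set {x. \<phi> x < a} p"
  have conn: "connected T"
    unfolding T_def by simp
  have Tsub: "\<phi> y < a" if "y \<in> T" for y
    using that connected_component_in[of "{x. \<phi> x < a}" p y] unfolding T_def by auto
  have "T \<subseteq> N"
  proof (cases "T = {}")
    case False
    then have "p \<in> T"
      unfolding T_def by (metis connected_component_eq_empty connected_component_refl_eq mem_Collect_eq)
    then have meet: "G \<inter> T \<noteq> {}" using C G by blast
    have "T \<inter> K = {}" using Tsub a by force
    then have "T \<subseteq> G \<union> - closure G" unfolding K_def by blast
    moreover have "G \<inter> - closure G \<inter> T = {}" using closure_subset by blast
    ultimately have "G \<inter> T = {} \<or> - closure G \<inter> T = {}"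
      using G(1) by (intro connectedD[OF conn]) auto
    then have "T \<subseteq> closure G" using meet by blast
    then show ?thesis using G by blast
  qed simp
  then show ?thesis
    using that a(1) unfolding T_def by blast
qed

text \<open>Hypothesis \<open>lower\<close> says that no point except \<open>p\<close> and \<open>q\<close> is a local minimum, hypothesis
  \<open>side\<close> that no point except these two is a saddle: locally the points below the level of
  \<open>x\<close> lie in one component of that sublevel set. The basin \<open>V\<close> of \<open>p\<close> is the union of those
  sublevel components of \<open>p\<close> that avoid \<open>q\<close> and on which \<open>\<phi>\<close> stays above \<open>\<phi> p\<close>. The second
  condition is what makes the basin relatively compact even though \<open>\<phi>\<close> may be unbounded
  below. Since \<open>\<phi> q \<le> \<phi> p\<close>, the point \<open>q\<close> is not on the frontier of the basin, where
  \<open>\<phi>\<close> is larger than \<open>\<phi> p\<close>.\<close>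

lemma proper_mountain_pass:
  fixes \<phi> :: "'m::t2_space \<Rightarrow> real"
  assumes lc: "locally_compact_space (euclidean :: 'm topology)"
    and conn: "connected (UNIV :: 'm set)"
    and loc: "\<And>U (x::'m). open U \<Longrightarrow> open (connected_component_set U x)"
    and cont: "continuous_on UNIV \<phi>"
    and proper: "\<And>a b. compact (\<phi> -` {a..b})"
    and pq: "p \<noteq> q" "\<phi> q \<le> \<phi> p"
    and strict: "open O\<^sub>p" "p \<in> O\<^sub>p" "\<And>y. y \<in> O\<^sub>p \<Longrightarrow> y \<noteq> p \<Longrightarrow> \<phi> p < \<phi> y"
    and lower: "\<And>x. x \<noteq> p \<Longrightarrow> x \<noteq> q \<Longrightarrow> x \<in> closure {y. \<phi> y < \<phi> x}"
    and side: "\<And>x. x \<noteq> p \<Longrightarrow> x \<noteq> q \<Longrightarrow> \<exists>N. open N \<and> x \<in> N \<and>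
      (\<forall>y\<in>N. \<forall>z\<in>N. \<phi> y < \<phi> x \<longrightarrow> \<phi> z < \<phi> x \<longrightarrow> connected_component {w. \<phi> w < \<phi> x} y z)"
  shows False
proof -
  define U where "U = (\<lambda>a. connected_component_set {x. \<phi> x < a} p)"
  define S where "S = {a. \<phi> p < a \<and> q \<notin> U a \<and> (\<forall>y\<in>U a. \<phi> p \<le> \<phi> y)}"
  define V where "V = (\<Union>a\<in>S. U a)"
  have opn: "open {x. \<phi> x < a}" for a
    using open_vimage[OF open_lessThan cont, of a] by (simp add: vimage_def)
  have openV: "open V"
    unfolding V_def U_def by (intro open_UN ballI loc opn)
  have U_less: "\<phi> y < a" if "y \<in> U a" for y a
    using that connected_component_in[of "{x. \<phi> x < a}" p y] unfolding U_def by auto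
  have pU: "p \<in> U a" if "\<phi> p < a" for a
    unfolding U_def using that by simp
  have "S \<noteq> {}"
  proof -
    obtain a where a: "\<phi> p < a" "U a \<subseteq> O\<^sub>p - {q}"
      unfolding U_def
      by (rule sublevel_component_trapped[OF lc cont, of "{p}" p "O\<^sub>p - {q}" "\<phi> p"])
        (use pq strict in auto)
    have "\<phi> p \<le> \<phi> y" if "y \<in> U a" for y
      using strict(3)[of y] a(2) that by (cases "y = p") auto
    then show ?thesis
      using a unfolding S_def by blast
  qed
  have pV: "p \<in> V"
    using \<open>S \<noteq> {}\<close> pU unfolding V_def S_def by blast
  have qV: "q \<notin> V" unfolding V_def S_def by blast
  have closV: "x \<in> V" if x: "x \<in> closure V" and a: "a \<in> S" "\<phi> x < a" for x a
  proof -
    let ?D = "connected_component_set {z. \<phi> z < a} x"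
    have "x \<in> ?D" using a by simp
    then have "V \<inter> ?D \<noteq> {}"
      using x loc[OF opn] by (meson closure_iff_nhds_not_empty subset_refl)
    then obtain y a' where y: "connected_component {z. \<phi> z < a} x y" "a' \<in> S" "y \<in> U a'"
      unfolding V_def by auto
    define b where "b = max a a'"
    have b: "b \<in> S" unfolding b_def using a y by (simp add: max_def)
    have "{z. \<phi> z < a} \<subseteq> {z. \<phi> z < b}" "{z. \<phi> z < a'} \<subseteq> {z. \<phi> z < b}"
      unfolding b_def by auto
    then have "connected_component {z. \<phi> z < b} p y" "connected_component {z. \<phi> z < b} y x"
      using y connected_component_of_subset connected_component_sym unfolding U_def by blast+
    then have "x \<in> U b"
      unfolding U_def using connected_component_trans by fast
    then show ?thesis using b unfolding V_def by blast
  qed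
  \<comment> \<open>Otherwise the basin would be closed and open, hence contain \<open>q\<close>.\<close>
  obtain x0 where x0: "x0 \<in> closure V" "x0 \<notin> V"
  proof -
    have "closure V \<noteq> V"
    proof
      assume "closure V = V"
      then have "closed V" by (metis closed_closure)
      then have "V = UNIV" using conn openV pV unfolding connected_clopen by fastforce
      then show False using qV by blast
    qed
    then show ?thesis using that closure_subset by blast
  qed
  then have ub: "a \<le> \<phi> x0" if "a \<in> S" for a
    using closV that by force
  then have bdd: "bdd_above S" by (auto simp: bdd_above_def)
  define c where "c = Sup S"
  have c: "a \<le> c" if "a \<in> S" for a
    unfolding c_def using cSup_upper[OF that bdd] .
  have pc: "\<phi> p < c"
    using \<open>S \<noteq> {}\<close> c unfolding S_def by fastforce
  have V_less: "\<phi> y < c" if "y \<in> V" for y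
    using that U_less c unfolding V_def by fastforce
  have V_ge: "\<phi> p \<le> \<phi> y" if "y \<in> V" for y
    using that unfolding V_def S_def by blast
  define C where "C = closure V"
  have "closed (\<phi> -` {\<phi> p..c})"
    using cont by (intro closed_vimage) auto
  moreover have "V \<subseteq> \<phi> -` {\<phi> p..c}"
    using V_less V_ge by (auto simp: less_imp_le)
  ultimately have Csub: "C \<subseteq> \<phi> -` {\<phi> p..c}"
    unfolding C_def by (rule closure_minimal[rotated])
  then have compC: "compact C"
    using compact_closed_subset[OF proper] unfolding C_def by blast
  have top: "\<phi> x = c" if "x \<in> C" "x \<notin> V" for x
  proof -
    have "a \<le> \<phi> x" if "a \<in> S" for a
      using closV[of x a] \<open>x \<in> C\<close> \<open>x \<notin> V\<close> that unfolding C_def by force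
    then have "c \<le> \<phi> x"
      unfolding c_def using \<open>S \<noteq> {}\<close> by (intro cSup_least) auto
    then show ?thesis using Csub \<open>x \<in> C\<close> by fastforce
  qed
  have qC: "q \<notin> C"
    using top[of q] qV pc pq(2) by fastforce
  have absorb: "z \<in> V" if cc: "connected_component {w. \<phi> w < c} y z" and y: "y \<in> V" for y z
  proof -
    obtain T where T: "connected T" "T \<subseteq> {w. \<phi> w < c}" "y \<in> T" "z \<in> T"
      using cc unfolding connected_component_def by blast
    have "T \<subseteq> V \<union> - C" using T(2) top by fastforce
    moreover have "V \<inter> - C \<inter> T = {}" unfolding C_def using closure_subset by blast
    ultimately have "V \<inter> T = {} \<or> - C \<inter> T = {}"
      using openV by (intro connectedD[OF T(1)]) (auto simp: C_def)
    then have "z \<in> C" using T y by blast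
    then show ?thesis using top[of z] T by auto
  qed
  \<comment> \<open>Near its closure, the basin is surrounded by values above \<open>c\<close>; so it could be enlarged
    beyond the level \<open>c\<close>.\<close>
  define N where "N = interior (C \<union> {x. c < \<phi> x})"
  have "C \<subseteq> N"
  proof
    fix x assume x: "x \<in> C"
    show "x \<in> N"
    proof (cases "x \<in> V")
      case True
      then show ?thesis
        unfolding N_def using openV closure_subset[of V] by (intro interiorI[of V]) (auto simp: C_def)
    next
      case False
      have \<phi>x: "\<phi> x = c" using top x False by blast
      have "x \<noteq> p" "x \<noteq> q" using False pV x qC by auto
      then obtain M where M: "open M" "x \<in> M" and
        MM: "\<And>y z. y \<in> M \<Longrightarrow> z \<in> M \<Longrightarrow> \<phi> y < c \<Longrightarrow> \<phi> z < c \<Longrightarrow> connected_component {w. \<phi> w < c} y z"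
        using side[of x] unfolding \<phi>x by blast
      have "V \<inter> M \<noteq> {}"
        using x M unfolding C_def by (meson closure_iff_nhds_not_empty subset_refl)
      then obtain v where v: "v \<in> V" "v \<in> M" by blast
      have MV: "M \<inter> {y. \<phi> y < c} \<subseteq> V"
        using MM[OF v(2)] V_less[OF v(1)] absorb[OF _ v(1)] by blast
      have "y \<in> C \<union> {x. c < \<phi> x}" if y: "y \<in> M" for y
      proof (cases "\<phi> y" c rule: linorder_cases)
        case less
        then show ?thesis using MV y closure_subset[of V] unfolding C_def by blast
      next
        case equal
        then have "y \<noteq> p" "y \<noteq> q" using pc pq by auto
        then have "y \<in> M \<inter> closure {z. \<phi> z < c}" using lower[of y] y equal by simp
        then have "y \<in> closure (M \<inter> {z. \<phi> z < c})"
          using open_Int_closure_subset[OF M(1)] by blast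
        then show ?thesis using closure_mono[OF MV] unfolding C_def by blast
      qed simp
      then show ?thesis
        unfolding N_def using M by (intro interiorI[of M]) auto
    qed
  qed
  have NN: "y \<in> C \<or> c < \<phi> y" if "y \<in> N" for y
    using that interior_subset unfolding N_def by blast
  have "open N" unfolding N_def by simp
  obtain a where a: "c < a" "U a \<subseteq> N - {q}"
    unfolding U_def
    by (rule sublevel_component_trapped[OF lc cont compC, of p "N - {q}" c])
      (use \<open>C \<subseteq> N\<close> \<open>open N\<close> qC NN pV closure_subset[of V] in \<open>auto simp: C_def\<close>)
  have "\<phi> p \<le> \<phi> y" if "y \<in> U a" for y
    using NN[of y] a(2) that Csub pc by fastforce
  then have "a \<in> S"
    unfolding S_def using a pc by auto
  then show False using c a(1) by fastforce
qed

section \<open>Functionals on Frechet manifolds\<close>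

lemma connected_component_path:
  fixes g :: "real \<Rightarrow> 'a::topological_space"
  assumes "continuous_on {a..b} g" "\<And>t. a \<le> t \<Longrightarrow> t \<le> b \<Longrightarrow> g t \<in> U" "a \<le> b"
  shows "connected_component U (g a) (g b)"
  unfolding connected_component_def
  using assms by (intro exI[of _ "g ` {a..b}"]) (auto intro!: connected_continuous_image)

context
  fixes A :: "('m::{t2_space, second_countable_topology}, 'f::frechet_space) chart set"
  assumes atlas: "C1_frechet_atlas A"
begin

lemma chart_at:
  obtains c where "c \<in> A" "x \<in> chart_dom c"
proof -
  have "x \<in> (\<Union>c\<in>A. chart_dom c)"
    using atlas unfolding C1_frechet_atlas_def by blast
  then show ?thesis using that by blast
qed

lemma chart_facts:
  assumes "c \<in> A"
  shows open_chart_dom: "open (chart_dom c)"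
    and open_chart_image: "open (chart_map c ` chart_dom c)"
    and continuous_on_chart_map: "continuous_on (chart_dom c) (chart_map c)"
    and continuous_on_chart_inv: "continuous_on (chart_map c ` chart_dom c) (chart_inv c)"
    and chart_inv_chart_map: "\<And>x. x \<in> chart_dom c \<Longrightarrow> chart_inv c (chart_map c x) = x"
    and open_chart_image_Int: "\<And>W. open W \<Longrightarrow> open (chart_map c ` (chart_dom c \<inter> W))"
proof -
  have *: "open (chart_dom c)" "open (chart_map c ` chart_dom c)"
    "homeomorphism (chart_dom c) (chart_map c ` chart_dom c) (chart_map c) (chart_inv c)"
    using atlas assms unfolding C1_frechet_atlas_def by auto
  show "open (chart_dom c)" "open (chart_map c ` chart_dom c)" by (fact *)+
  show "continuous_on (chart_dom c) (chart_map c)"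
    "continuous_on (chart_map c ` chart_dom c) (chart_inv c)"
    "\<And>x. x \<in> chart_dom c \<Longrightarrow> chart_inv c (chart_map c x) = x"
    using *(3) unfolding homeomorphism_def by auto
  fix W :: "'m set" assume W: "open W"
  have "openin (top_of_set (chart_map c ` chart_dom c)) (chart_map c ` (chart_dom c \<inter> W))"
    using *(3) W by (intro homeomorphism_imp_open_map) (auto simp: openin_open)
  then show "open (chart_map c ` (chart_dom c \<inter> W))"
    using *(2) openin_open_trans by blast
qed

lemma open_chart_preimage:
  assumes "c \<in> A" "open B"
  shows "open (chart_dom c \<inter> chart_map c -` B)"
  using continuous_open_preimage[OF continuous_on_chart_map open_chart_dom] assms by blast

lemma chart_inv_in_Int:
  assumes "c \<in> A" "u \<in> chart_map c ` (chart_dom c \<inter> W)"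
  shows "chart_inv c u \<in> chart_dom c" "chart_inv c u \<in> W" "chart_map c (chart_inv c u) = u"
proof -
  obtain x where x: "x \<in> chart_dom c" "x \<in> W" "u = chart_map c x"
    using assms(2) by blast
  have "chart_inv c u = x"
    unfolding x(3) by (rule chart_inv_chart_map[OF assms(1) x(1)])
  with x show "chart_inv c u \<in> chart_dom c" "chart_inv c u \<in> W" "chart_map c (chart_inv c u) = u"
    by simp_all
qed

lemma manifold_open_component:
  assumes U: "open (U :: 'm set)"
  shows "open (connected_component_set U x)"
proof (rule topological_space_class.openI)
  fix y assume "y \<in> connected_component_set U x"
  then have xy: "connected_component U x y" by simp
  then have "y \<in> U" using connected_component_in by metis
  obtain c where c: "c \<in> A" "y \<in> chart_dom c" by (rule chart_at)
  have "open (chart_map c ` (chart_dom c \<inter> U))" "chart_map c y \<in> chart_map c ` (chart_dom c \<inter> U)"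
    using open_chart_image_Int[OF c(1) U] c \<open>y \<in> U\<close> by auto
  then obtain B where B: "open B" "convex B" "chart_map c y \<in> B"
    "B \<subseteq> chart_map c ` (chart_dom c \<inter> U)"
    by (rule frechet_convex_nhd)
  have "connected_component U y z" if z: "z \<in> chart_dom c" "chart_map c z \<in> B" for z
  proof -
    obtain T where T: "connected T" "T \<subseteq> B" "chart_map c y \<in> T" "chart_map c z \<in> T"
      using connected_component_segment[OF B(2,3) z(2)] unfolding connected_component_def by blast
    have "continuous_on T (chart_inv c)"
      using continuous_on_chart_inv[OF c(1)] by (rule continuous_on_subset) (use T B in blast)
    then have "connected (chart_inv c ` T)"
      using T(1) connected_continuous_image by blast
    moreover have "chart_inv c ` T \<subseteq> U"
      using T(2) B(4) chart_inv_in_Int[OF c(1)] by blast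
    moreover have "y \<in> chart_inv c ` T" "z \<in> chart_inv c ` T"
      using T(3,4) chart_inv_chart_map[OF c(1)] c(2) z(1) by (metis imageI)+
    ultimately show ?thesis unfolding connected_component_def by blast
  qed
  then have "chart_dom c \<inter> chart_map c -` B \<subseteq> connected_component_set U x"
    using connected_component_trans[OF xy] by auto
  then show "\<exists>T. open T \<and> y \<in> T \<and> T \<subseteq> connected_component_set U x"
    using open_chart_preimage[OF c(1) B(1)] c(2) B(3) by blast
qed

lemma C1_functional_continuous:
  assumes "C1_functional A \<phi>"
  shows "continuous_on UNIV \<phi>"
proof -
  have "continuous_on (chart_dom c) \<phi>" if c: "c \<in> A" for c
  proof -
    have "continuous_on (chart_map c ` chart_dom c) (\<phi> \<circ> chart_inv c)"
      using assms c unfolding C1_functional_def keller_C1_on_def by blast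
    then have "continuous_on (chart_dom c) ((\<phi> \<circ> chart_inv c) \<circ> chart_map c)"
      by (rule continuous_on_compose[OF continuous_on_chart_map[OF c]])
    then show ?thesis
      by (rule continuous_on_eq) (simp add: chart_inv_chart_map[OF c])
  qed
  then have "continuous_on (\<Union>c\<in>A. chart_dom c) \<phi>"
    using open_chart_dom by (intro continuous_on_open_UN) auto
  then show ?thesis
    using atlas unfolding C1_frechet_atlas_def by simp
qed

lemma local_minimum_imp_critical:
  assumes \<phi>: "C1_functional A \<phi>" and min: "local_minimum_point \<phi> x"
  shows "critical_point A \<phi> x"
proof -
  obtain U where U: "open U" "x \<in> U" "\<And>y. y \<in> U \<Longrightarrow> \<phi> x \<le> \<phi> y"
    using min unfolding local_minimum_point_def by blast
  obtain c where c: "c \<in> A" "x \<in> chart_dom c" by (rule chart_at)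
  have "dir_derivative (\<phi> \<circ> chart_inv c) (chart_map c x) h = 0" for h
  proof (rule keller_C1_local_min)
    show "keller_C1_on (chart_map c ` chart_dom c) (\<phi> \<circ> chart_inv c)"
      using \<phi> c unfolding C1_functional_def by blast
    show "open (chart_map c ` (chart_dom c \<inter> U))"
      using open_chart_image_Int c U by blast
    show "chart_map c x \<in> chart_map c ` (chart_dom c \<inter> U)" using c U by blast
    show "chart_map c ` (chart_dom c \<inter> U) \<subseteq> chart_map c ` chart_dom c" by blast
    show "(\<phi> \<circ> chart_inv c) (chart_map c x) \<le> (\<phi> \<circ> chart_inv c) y"
      if "y \<in> chart_map c ` (chart_dom c \<inter> U)" for y
      using chart_inv_in_Int[OF c(1) that] chart_inv_chart_map[OF c] U(3) by simp
  qed
  then show ?thesis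
    using c unfolding critical_point_def by blast
qed

lemma regular_monotone_box:
  assumes \<phi>: "C1_functional A \<phi>" and reg: "\<not> critical_point A \<phi> x"
    and c: "c \<in> A" "x \<in> chart_dom c" and W: "open W" "x \<in> W"
  obtains B h s where "open B" "convex B" "chart_map c x \<in> B" "0 < s"
    "\<And>b t. b \<in> B \<Longrightarrow> \<bar>t\<bar> \<le> s \<Longrightarrow> b + t *\<^sub>R h \<in> chart_map c ` (chart_dom c \<inter> W)"
    "\<And>b t t'. b \<in> B \<Longrightarrow> - s \<le> t \<Longrightarrow> t < t' \<Longrightarrow> t' \<le> s \<Longrightarrow>
      \<phi> (chart_inv c (b + t *\<^sub>R h)) < \<phi> (chart_inv c (b + t' *\<^sub>R h))"
    "\<And>b. b \<in> B \<Longrightarrow> \<phi> (chart_inv c (b + (- s) *\<^sub>R h)) < \<phi> x"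
    "\<And>b. b \<in> B \<Longrightarrow> \<phi> x < \<phi> (chart_inv c (b + s *\<^sub>R h))"
proof -
  let ?V = "chart_map c ` (chart_dom c \<inter> W)"
  have k: "keller_C1_on (chart_map c ` chart_dom c) (\<phi> \<circ> chart_inv c)"
    using \<phi> c unfolding C1_functional_def by blast
  have V: "open ?V" "chart_map c x \<in> ?V" "?V \<subseteq> chart_map c ` chart_dom c"
    using open_chart_image_Int c W by auto
  obtain k where "dir_derivative (\<phi> \<circ> chart_inv c) (chart_map c x) k \<noteq> 0"
    using reg c unfolding critical_point_def by blast
  from keller_C1_monotone_box[OF k V this] show ?thesis
    using that unfolding comp_apply chart_inv_chart_map[OF c] by metis
qed

lemma continuous_on_chart_inv_line:
  assumes "c \<in> A" "\<And>t. t \<in> S \<Longrightarrow> g t \<in> chart_map c ` chart_dom c" "continuous_on S g"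
  shows "continuous_on S (\<lambda>t. chart_inv c (g t))"
  using continuous_on_compose2[OF continuous_on_chart_inv[OF assms(1)] assms(3)] assms(2) by blast

text \<open>The segments of a monotone box around \<open>x\<close> all cross the fibre through \<open>x\<close>. If this fibre
  is compact, then the box lies in the image of a compact set under \<open>(y, t) \<mapsto> y - t h\<close>; so the
  model space, and with it the manifold, is locally compact.\<close>

lemma compact_regular_fibre_imp_locally_compact:
  assumes \<phi>: "C1_functional A \<phi>" and reg: "\<not> critical_point A \<phi> x"
    and fibre: "compact {y. \<phi> y = \<phi> x}"
  shows "locally_compact_space (euclidean :: 'm topology)"
proof -
  obtain c where c: "c \<in> A" "x \<in> chart_dom c" by (rule chart_at)
  obtain W C where W: "open W" "x \<in> W" and C: "compact C"
      "C \<subseteq> {y. \<phi> y = \<phi> x} \<inter> chart_dom c" "{y. \<phi> y = \<phi> x} \<inter> W \<subseteq> C"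
    by (rule compact_nhd_in_open[OF fibre open_chart_dom[OF c(1)] c(2)])
  obtain B h s where B: "open B" "chart_map c x \<in> B" "0 < s"
    and inW: "\<And>b t. b \<in> B \<Longrightarrow> \<bar>t\<bar> \<le> s \<Longrightarrow> b + t *\<^sub>R h \<in> chart_map c ` (chart_dom c \<inter> W)"
    and lo: "\<And>b. b \<in> B \<Longrightarrow> \<phi> (chart_inv c (b + (- s) *\<^sub>R h)) < \<phi> x"
    and hi: "\<And>b. b \<in> B \<Longrightarrow> \<phi> x < \<phi> (chart_inv c (b + s *\<^sub>R h))"
    by (rule regular_monotone_box[OF \<phi> reg c W]) metis
  define E where "E = (\<lambda>(y, t). y - t *\<^sub>R h) ` (chart_map c ` C \<times> {- s..s})"
  have "compact (chart_map c ` C)"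
    using C continuous_on_subset[OF continuous_on_chart_map[OF c(1)]]
    by (intro compact_continuous_image) auto
  then have "compact (chart_map c ` C \<times> {- s..s})"
    by (intro compact_Times compact_Icc)
  then have E: "compact E"
    unfolding E_def case_prod_beta
    by (rule compact_continuous_image[rotated]) (intro continuous_intros)
  have "B \<subseteq> E"
  proof
    fix b assume b: "b \<in> B"
    let ?g = "\<lambda>t. chart_inv c (b + t *\<^sub>R h)"
    have "continuous_on {- s..s} ?g"
    proof (rule continuous_on_chart_inv_line[OF c(1)])
      show "b + t *\<^sub>R h \<in> chart_map c ` chart_dom c" if "t \<in> {- s..s}" for t
        using inW[OF b, of t] that by (auto simp: abs_le_iff)
    qed (intro continuous_intros)
    then have "continuous_on {- s..s} (\<lambda>t. \<phi> (?g t))"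
      by (rule continuous_on_compose2[OF C1_functional_continuous[OF \<phi>]]) auto
    then obtain t where t: "- s \<le> t" "t \<le> s" "\<phi> (?g t) = \<phi> x"
      using IVT'[of "\<lambda>t. \<phi> (?g t)" "- s" "\<phi> x" s] lo[OF b] hi[OF b] B(3) by auto
    have "b + t *\<^sub>R h \<in> chart_map c ` (chart_dom c \<inter> W)"
      using inW[OF b, of t] t by (simp add: abs_le_iff)
    note gt = chart_inv_in_Int[OF c(1) this]
    have "?g t \<in> C" using gt t C(3) by blast
    then have "b + t *\<^sub>R h \<in> chart_map c ` C" using gt(3) by (metis imageI)
    then have "(b + t *\<^sub>R h, t) \<in> chart_map c ` C \<times> {- s..s}" using t by simp
    then show "b \<in> E" unfolding E_def by (rule rev_image_eqI) simp
  qed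
  show ?thesis
    unfolding locally_compact_space_def
  proof
    fix y :: 'm
    obtain d where d: "d \<in> A" "y \<in> chart_dom d" by (rule chart_at)
    let ?\<tau> = "\<lambda>v. v + (chart_map d y - chart_map c x)"
    let ?\<sigma> = "\<lambda>v. v - (chart_map d y - chart_map c x)"
    have E': "compact (?\<tau> ` E)"
      by (intro compact_continuous_image continuous_intros E)
    obtain W' C' where W': "open W'" "chart_map d y \<in> W'" and C': "compact C'"
        "C' \<subseteq> ?\<tau> ` E \<inter> chart_map d ` chart_dom d" "?\<tau> ` E \<inter> W' \<subseteq> C'"
      by (rule compact_nhd_in_open[OF E' open_chart_image[OF d(1)], of "chart_map d y"]) (use d in auto)
    define B' where "B' = ?\<sigma> -` B \<inter> W'"
    have "open (?\<sigma> -` B)"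
      by (intro open_vimage B(1) continuous_intros)
    then have "open B'" unfolding B'_def using W'(1) by blast
    then have "open (chart_dom d \<inter> chart_map d -` B')"
      by (rule open_chart_preimage[OF d(1)])
    moreover have "y \<in> chart_dom d \<inter> chart_map d -` B'"
      unfolding B'_def using d W' B(2) by simp
    moreover have "compact (chart_inv d ` C')"
      using C' continuous_on_subset[OF continuous_on_chart_inv[OF d(1)]]
      by (intro compact_continuous_image) auto
    moreover have "chart_dom d \<inter> chart_map d -` B' \<subseteq> chart_inv d ` C'"
    proof
      fix z assume z: "z \<in> chart_dom d \<inter> chart_map d -` B'"
      then have "?\<sigma> (chart_map d z) \<in> E" using \<open>B \<subseteq> E\<close> unfolding B'_def by blast
      then have "?\<tau> (?\<sigma> (chart_map d z)) \<in> ?\<tau> ` E" by (rule imageI)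
      then have "chart_map d z \<in> C'" using z C'(3) unfolding B'_def by auto
      then show "z \<in> chart_inv d ` C'"
        using z chart_inv_chart_map[OF d(1)] by (metis IntD1 imageI)
    qed
    ultimately show "\<exists>U K. openin euclidean U \<and> compactin euclidean K \<and> y \<in> U \<and> U \<subseteq> K"
      by auto
  qed
qed

text \<open>Two points of a monotone box below the level of \<open>x\<close> can be joined below this level: move
  both down along \<open>h\<close> until the whole translate of the convex box lies below the level, then
  join them by a segment.\<close>

lemma regular_sublevel_connected:
  assumes \<phi>: "C1_functional A \<phi>" and reg: "\<not> critical_point A \<phi> x"
  shows "\<exists>N. open N \<and> x \<in> N \<and> (\<forall>y\<in>N. \<forall>z\<in>N. \<phi> y < \<phi> x \<longrightarrow> \<phi> z < \<phi> x \<longrightarrow>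
    connected_component {w. \<phi> w < \<phi> x} y z)"
proof -
  let ?L = "{w. \<phi> w < \<phi> x}"
  obtain c where c: "c \<in> A" "x \<in> chart_dom c" by (rule chart_at)
  obtain B h s where B: "open B" "convex B" "chart_map c x \<in> B" "0 < s"
    and inU: "\<And>b t. b \<in> B \<Longrightarrow> \<bar>t\<bar> \<le> s \<Longrightarrow> b + t *\<^sub>R h \<in> chart_map c ` (chart_dom c \<inter> UNIV)"
    and mono: "\<And>b t t'. b \<in> B \<Longrightarrow> - s \<le> t \<Longrightarrow> t < t' \<Longrightarrow> t' \<le> s \<Longrightarrow>
      \<phi> (chart_inv c (b + t *\<^sub>R h)) < \<phi> (chart_inv c (b + t' *\<^sub>R h))"
    and lo: "\<And>b. b \<in> B \<Longrightarrow> \<phi> (chart_inv c (b + (- s) *\<^sub>R h)) < \<phi> x"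
    by (rule regular_monotone_box[OF \<phi> reg c open_UNIV UNIV_I]) metis
  let ?N = "chart_dom c \<inter> chart_map c -` B"
  let ?low = "\<lambda>y. chart_inv c (chart_map c y + (- s) *\<^sub>R h)"
  have down: "connected_component ?L (?low y) y" if y: "y \<in> ?N" "\<phi> y < \<phi> x" for y
  proof -
    let ?g = "\<lambda>t. chart_inv c (chart_map c y + t *\<^sub>R h)"
    have b: "chart_map c y \<in> B" using y by blast
    have g0: "?g 0 = y" using chart_inv_chart_map[OF c(1)] y by simp
    have "connected_component ?L (?g (- s)) (?g 0)"
    proof (rule connected_component_path)
      show "continuous_on {- s..0} ?g"
      proof (rule continuous_on_chart_inv_line[OF c(1)])
        show "chart_map c y + t *\<^sub>R h \<in> chart_map c ` chart_dom c" if "t \<in> {- s..0}" for t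
          using inU[OF b, of t] that by (auto simp: abs_le_iff)
      qed (intro continuous_intros)
      show "?g t \<in> ?L" if "- s \<le> t" "t \<le> 0" for t
      proof (cases "t = 0")
        case True
        then show ?thesis using g0 y(2) by simp
      next
        case False
        then have "\<phi> (?g t) < \<phi> (?g 0)" using mono[OF b, of t 0] that B(4) by simp
        then show ?thesis unfolding g0 using y(2) by simp
      qed
    qed (use B(4) in simp)
    then show ?thesis unfolding g0 .
  qed
  have across: "connected_component ?L (?low y) (?low z)" if yz: "y \<in> ?N" "z \<in> ?N" for y z
  proof -
    let ?m = "\<lambda>t. chart_map c y + t *\<^sub>R (chart_map c z - chart_map c y)"
    let ?g = "\<lambda>t. chart_inv c (?m t + (- s) *\<^sub>R h)"
    have m: "?m t \<in> B" if "0 \<le> t" "t \<le> 1" for t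
    proof -
      have "(1 - t) *\<^sub>R chart_map c y + t *\<^sub>R chart_map c z \<in> B"
        using B(2) yz that by (auto simp: convex_alt)
      then show ?thesis by (simp add: algebra_simps)
    qed
    have "connected_component ?L (?g 0) (?g 1)"
    proof (rule connected_component_path)
      show "continuous_on {0..1} ?g"
      proof (rule continuous_on_chart_inv_line[OF c(1)])
        show "?m t + (- s) *\<^sub>R h \<in> chart_map c ` chart_dom c" if "t \<in> {0..1}" for t
          using inU[OF m, of t "- s"] that B(4) by auto
      qed (intro continuous_intros)
      show "?g t \<in> ?L" if "0 \<le> t" "t \<le> 1" for t
        using lo[OF m[OF that]] by simp
    qed simp
    then show ?thesis by simp
  qed
  have "connected_component ?L y z" if "y \<in> ?N" "z \<in> ?N" "\<phi> y < \<phi> x" "\<phi> z < \<phi> x" for y z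
    using down[of y] down[of z] across[of y z] that
    by (meson connected_component_sym connected_component_trans)
  moreover have "open ?N" "x \<in> ?N"
    using open_chart_preimage[OF c(1) B(1)] c(2) B(3) by auto
  ultimately show ?thesis by blast
qed

end

section \<open>A third critical point\<close>

lemma uncountable_range_nonconstant:
  fixes \<phi> :: "'m::topological_space \<Rightarrow> real"
  assumes "connected (UNIV :: 'm set)" "continuous_on UNIV \<phi>" "\<not> \<phi> constant_on UNIV"
  shows "uncountable (range \<phi>)"
proof -
  obtain x y where "\<phi> x < \<phi> y"
    using assms(3) unfolding constant_on_def by (metis linorder_neqE_linordered_idom)
  moreover have "connected (range \<phi>)"
    using assms(1,2) connected_continuous_image by blast
  ultimately have "{\<phi> x<..<\<phi> y} \<subseteq> range \<phi>"
    unfolding connected_iff_interval by (meson greaterThanLessThan_iff less_imp_le rangeI subsetI)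
  then show ?thesis
    using uncountable_open_interval[of "\<phi> x" "\<phi> y"] \<open>\<phi> x < \<phi> y\<close> countable_subset by blast
qed

theorem theorem3p6:
  fixes A :: "('m::{t2_space, second_countable_topology}, 'f::frechet_space) chart set"
    and N :: "nat \<Rightarrow> ('m, 'f) tangent \<Rightarrow> real"
    and \<phi> :: "'m \<Rightarrow> real"
    and p q :: 'm
  assumes manifold: "C1_frechet_atlas A"
    and connected: "connected (UNIV :: 'm set)"
    and finsler: "graded_finsler_structure A N"
    and complete: "Metric_space.mcomplete UNIV (finsler_metric A N)"
    and C1: "C1_functional A \<phi>"
    and nonconstant: "\<not> \<phi> constant_on UNIV"
    and closed: "closed_map euclidean euclidean \<phi>"
    and PS: "\<forall>c. palais_smale A N \<phi> c UNIV"
    and minima: "p \<noteq> q" "local_minimum_point \<phi> p" "local_minimum_point \<phi> q"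
  shows "\<exists>z. critical_point A \<phi> z \<and> z \<noteq> p \<and> z \<noteq> q"
proof (rule ccontr)
  assume "\<not> ?thesis"
  then have reg: "\<not> critical_point A \<phi> x" if "x \<noteq> p" "x \<noteq> q" for x
    using that by blast
  have cont: "continuous_on UNIV \<phi>"
    by (rule C1_functional_continuous[OF manifold C1])
  have notmin: "\<not> local_minimum_point \<phi> x" if "x \<noteq> p" "x \<noteq> q" for x
    using local_minimum_imp_critical[OF manifold C1] reg that by blast
  \<comment> \<open>A level with compact fibre that contains neither \<open>p\<close> nor \<open>q\<close>.\<close>
  have "uncountable (range \<phi> - {c. \<not> compact {x. \<phi> x = c}} - {\<phi> p, \<phi> q})"
    using uncountable_range_nonconstant[OF connected cont nonconstant]
      countable_noncompact_fibres[OF closed] by (simp add: uncountable_minus_countable)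
  then have "range \<phi> - {c. \<not> compact {x. \<phi> x = c}} - {\<phi> p, \<phi> q} \<noteq> {}"
    using countable_empty by metis
  then obtain x where x: "compact {y. \<phi> y = \<phi> x}" "\<phi> x \<noteq> \<phi> p" "\<phi> x \<noteq> \<phi> q"
    by blast
  then have "x \<noteq> p" "x \<noteq> q" by auto
  then have lc: "locally_compact_space (euclidean :: 'm topology)"
    using compact_regular_fibre_imp_locally_compact[OF manifold C1 reg x(1)] by blast
  have no_isolated: "\<not> open {y}" for y :: 'm
  proof
    assume "open {y}"
    then have "openin (top_of_set UNIV) {y}" "closedin (top_of_set UNIV) {y}"
      by simp_all
    then have "{y} = UNIV"
      using connected unfolding connected_clopen by blast
    then have "p \<in> {y}" "q \<in> {y}" by simp_all
    then show False using \<open>p \<noteq> q\<close> by simp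
  qed
  have no_interior: "interior {x. \<phi> x = c} = {}" for c
  proof (rule ccontr)
    let ?I = "interior {x. \<phi> x = c}"
    assume "?I \<noteq> {}"
    then obtain y where y: "y \<in> ?I" by blast
    have level: "\<phi> z = c" if "z \<in> ?I" for z
      using subsetD[OF interior_subset that] by simp
    have "local_minimum_point \<phi> z" if "z \<in> ?I" for z
      unfolding local_minimum_point_def
      using that level by (intro exI[of _ ?I] conjI ballI) simp_all
    then have "?I \<subseteq> {p, q}" using notmin by blast
    then have "{y} = ?I - ({p, q} - {y})" using y by blast
    moreover have "open (?I - ({p, q} - {y}))"
      by (intro open_Diff finite_imp_closed) auto
    ultimately show False using no_isolated by metis
  qed
  have proper: "compact (\<phi> -` {a..b})" for a b
    using closed_map_compact_fibres_preimage[OF closed]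
      compact_fibres_if_empty_interior[OF cont closed lc no_interior] by blast
  have lower: "x \<in> closure {y. \<phi> y < \<phi> x}" if "x \<noteq> p" "x \<noteq> q" for x
  proof (rule ccontr)
    assume x: "x \<notin> closure {y. \<phi> y < \<phi> x}"
    have "local_minimum_point \<phi> x"
      unfolding local_minimum_point_def
    proof (intro exI[of _ "- closure {y. \<phi> y < \<phi> x}"] conjI ballI)
      show "\<phi> x \<le> \<phi> y" if "y \<in> - closure {y. \<phi> y < \<phi> x}" for y
        using that closure_subset[of "{y. \<phi> y < \<phi> x}"] by force
    qed (use x in auto)
    then show False using notmin that by blast
  qed
  have False if r: "r \<noteq> r'" "\<phi> r' \<le> \<phi> r" "{r, r'} = {p, q}" for r r'
  proof -
    have pq: "x \<noteq> p \<and> x \<noteq> q \<longleftrightarrow> x \<noteq> r \<and> x \<noteq> r'" for x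
      using r(3) by blast
    have "local_minimum_point \<phi> r" using r(3) minima by auto
    then obtain O\<^sub>r where O\<^sub>r: "open O\<^sub>r" "r \<in> O\<^sub>r" "\<And>y. y \<in> O\<^sub>r \<Longrightarrow> \<phi> r \<le> \<phi> y"
      unfolding local_minimum_point_def by blast
    have strict: "\<phi> r < \<phi> y" if y: "y \<in> O\<^sub>r - {r'}" "y \<noteq> r" for y
    proof (rule ccontr)
      assume "\<not> \<phi> r < \<phi> y"
      then have "local_minimum_point \<phi> y"
        unfolding local_minimum_point_def using O\<^sub>r y by (intro exI[of _ O\<^sub>r]) fastforce
      then show False using notmin pq y by blast
    qed
    show False
    proof (rule proper_mountain_pass[OF lc connected _ cont proper r(1,2)])
      show "open (O\<^sub>r - {r'})" "r \<in> O\<^sub>r - {r'}"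
        using O\<^sub>r(1,2) r(1) by (simp_all add: open_Diff)
      show "x \<in> closure {y. \<phi> y < \<phi> x}" if "x \<noteq> r" "x \<noteq> r'" for x
        using lower pq that by blast
      show "\<exists>N. open N \<and> x \<in> N \<and> (\<forall>y\<in>N. \<forall>z\<in>N. \<phi> y < \<phi> x \<longrightarrow> \<phi> z < \<phi> x \<longrightarrow>
          connected_component {w. \<phi> w < \<phi> x} y z)" if "x \<noteq> r" "x \<noteq> r'" for x
        by (rule regular_sublevel_connected[OF manifold C1 reg]) (use pq that in auto)
    qed (fact manifold_open_component[OF manifold] strict)+
  qed
  from this[of p q] this[of q p] minima(1) show False
    by (metis insert_commute linorder_le_cases)
qed

end
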